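(* Let $K\in\mathbb N$ and $M\ge \max(2,K+1)$, let $Y$ be the state process described in the context and $\mathbb Y$ its signature. For any signature-linear offset $\delta=(\delta^a,\delta^b)=(\langle\boldsymbol\alpha^a,\mathbb Y_\cdot\rangle,\langle\boldsymbol\alpha^b,\mathbb Y_\cdot\rangle)\in\mathcal D^{\mathrm{sig}}$, the execution revenue $Z^\delta$ and the inventory profit-and-loss $I$ satisfy, for all $t\in[0,T]$, almost surely, $$Z^\delta_t=\langle(\boldsymbol\alpha^a;\epsilon_a)^{\sim}+(\boldsymbol\alpha^b;\epsilon_b)^{\sim},\mathbb Y_t\rangle,\qquad I_t=\langle(\epsilon_b-\epsilon_a;\epsilon_s)^{\sim},\mathbb Y_t\rangle .$$
   Context: **Tensor algebra.** For $d\in\mathbb N$, $T((\mathbb R^d))$ is the set of sequences $\mathbf u=(\mathbf u^{(0)},\mathbf u^{(1)},\dots)$ with $\mathbf u^{(n)}\in(\mathbb R^d)^{\otimes n}$ (where $(\mathbb R^d)^{\otimes 0}:=\mathbb R$), and $T(\mathbb R^d)$ is the subset of sequences with finitely many nonzero entries. For a multi-index $J=(j_1,\dots,j_n)$ with entries in an index set (alphabet) of size $d$ labelling the canonical basis of $\mathbb R^d$, set $|J|:=n$ and $\epsilon_J:=\epsilon_{j_1}\otimes\cdots\otimes\epsilon_{j_n}$; $\epsilon_\emptyset$ is the basis element of $(\mathbb R^d)^{\otimes 0}$ and $|\emptyset|=0$. Set $J':=(j_1,\dots,j_{n-1})$ if $n>1$, $J':=\emptyset$ if $n=1$, and $J'':=(J')'$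 for $n>1$, with the convention $\epsilon_{J''}=0$ for $n=1$. For $\mathbf x\in T((\mathbb R^d))$ write $\mathbf x_J=\langle\epsilon_J,\mathbf x\rangle$ for its $J$-coordinate, and for $\mathbf u\in T(\mathbb R^d)$, $\langle\mathbf u,\mathbf x\rangle:=\sum_{|J|\ge0}\mathbf u_J\mathbf x_J$ (a finite sum). **Signature of a càdlàg semimartingale.** Fix $T>0$. For an $\mathbb R^d$-valued càdlàg semimartingale $X=(X_t)_{t\in[0,T]}$, its signature is the $T((\mathbb R^d))$-valued process $\mathbb X=(\mathbb X_t)_{t\in[0,T]}$ with $\langle\epsilon_\emptyset,\mathbb X_t\rangle=1$ and, for each $J=(j_1,\dots,j_{|J|})$ with $|J|>0$, $$\langle \epsilon_J,\mathbb X_t\rangle=\int_0^t\langle\epsilon_{J'},\mathbb X_{u^-}\rangle\,dX^{j_{|J|}}_u+\frac12\,1_{\{|J|>1\}}\int_0^t\langle\epsilon_{J''},\mathbb X_{u^-}\rangle\,d[X^{j_{|J|-1}},X^{j_{|J|}}]^c_u+\sum_{0<u\le t}\ \sum_{\epsilon_{J_1}\otimes\epsilon_{J_2}=\epsilon_J}\frac{1}{|J_2|!}1_{\{|J_2|>1\}}\langle\epsilon_{J_1},\mathbb X_{u^-}\rangle\,\langle\epsilon_{J_2},(\Delta X_u)^{\otimes|J_2|}\rangle ,$$ where $[\cdot,\cdot]^c$ is the continuous part of the quadratic covariation and the integrals are It\^o integrals over $(0,t]$. **State process.** On a filtered probability space, $S=(S_t)_{t\in[0,T]}$ is a continuous real-valued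 semimartingale (the mid-price) and $N^a,N^b$ are adapted counting processes, i.e. nondecreasing càdlàg pure-jump processes with values in $\mathbb N$ (including $0$), started at $0$; their jumps need not be of size one. It is assumed that $\Delta N^a_t\,\Delta N^b_t=0$ for all $t$. For $M\ge2$ the state process $Y$ has components indexed by the alphabet $\mathcal A=\{0,s,qs,a,a^2,\dots,a^M,b,b^2,\dots,b^M\}$ (of size $3+2M$): $$Y^0_t=t,\quad Y^s_t=S_t,\quad Y^{qs}_t=[S]_t,\quad Y^a_t=N^a_t,\quad Y^b_t=N^b_t,\quad Y^{a^m}_t=\sum_{u\le t}(\Delta N^a_u)^m,\quad Y^{b^m}_t=\sum_{u\le t}(\Delta N^b_u)^m\quad(2\le m\le M).$$ $\mathbb Y$ denotes the signature of $Y$. **Tilde transform.** For a multi-index $J$ with entries in $\{0,s,a,b\}$ (last entry $j_{|J|}$ when $|J|>0$) and $j\in\{0,s,a,b\}$, define $$(\epsilon_J;\epsilon_j)^{\sim}:=\epsilon_J\otimes\epsilon_j-\tfrac12\,\epsilon_{J'}\otimes\epsilon_{qs}\,1_{\{j_{|J|}=j=s\}}+\sum_{\epsilon_{J_1}\otimes\epsilon_{J_2}=\epsilon_J}\boldsymbol\alpha(|J_2|)\,(\epsilon_{J_1}\otimes\epsilon_{a^{|J_2|+1}})\,1_{\{j=a\}}1_{\{J_2=(a,\dots,a)\}}+\sum_{\epsilon_{J_1}\otimes\epsilon_{J_2}=\epsilon_J}\boldsymbol\alpha(|J_2|)\,(\epsilon_{J_1}\otimes\epsilon_{b^{|J_2|+1}})\,1_{\{j=b\}}1_{\{J_2=(b,\dots,b)\}},$$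 where, in the last two sums, $J_2$ ranges over nonempty suffixes of $J$, and $$\boldsymbol\alpha(r):=\sum_{k=1}^r(-1)^k\boldsymbol\alpha(r,k),\qquad \boldsymbol\alpha(r,k):=\sum_{(i_1,\dots,i_k)\in\mathcal I(r,k)}\ \prod_{l=1}^k\frac1{(i_l+1)!},$$ with $\mathcal I(r,k)$ the set of $(i_1,\dots,i_k)\in\mathbb N^k$ with all $i_l\ge1$ and $i_1+\dots+i_k=r$. (These scalars $\boldsymbol\alpha(r)$ are unrelated to the control tensors $\boldsymbol\alpha^a,\boldsymbol\alpha^b$.) For a finite linear combination $\mathbf u=\sum_J u_J\epsilon_J$ over multi-indices $J$ with entries in $\{0,s,a,b\}$, set $(\mathbf u;\epsilon_j)^{\sim}:=\sum_J u_J(\epsilon_J;\epsilon_j)^{\sim}$. **Signature-linear offsets.** For fixed $K\in\mathbb N$, $\mathcal D^{\mathrm{sig}}$ is the set of pairs $\delta=(\delta^a,\delta^b)$ of processes of the form $\delta^{a}_t=\langle\boldsymbol\alpha^{a},\mathbb Y_t\rangle=\sum_{|J|\le K}\boldsymbol\alpha^{a}_J\langle\epsilon_J,\mathbb Y_t\rangle$ and $\delta^{b}_t=\langle\boldsymbol\alpha^{b},\mathbb Y_t\rangle=\sum_{|J|\le K}\boldsymbol\alpha^{b}_J\langle\epsilon_J,\mathbb Y_t\rangle$, with real coefficients such that $\boldsymbol\alpha^a_J=\boldsymbol\alpha^b_J=0$ whenever $J$ contains a letter outside $\{0,s,a,b\}$. The letter $\delta$ stands for the ask and bid half-spreads quoted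 by a market maker. **Execution revenue and inventory P\&L.** The inventory is $Q_t:=N^b_t-N^a_t$, and $Z^\delta_0=I_0=0$ with $$Z^\delta_t=\int_0^t\delta^a_{u^-}\,dN^a_u+\int_0^t\delta^b_{u^-}\,dN^b_u,\qquad I_t=\int_0^tQ_u\,dS_u .$$ *)

theory Defs
  imports "HOL-Probability.Probability" "HOL-Library.Poly_Mapping"
begin

section \<open>Paths and processes on a finite horizon\<close>

text \<open>Processes are functions \<^typ>\<open>real \<Rightarrow> 'a \<Rightarrow> real\<close>; only their values at times in \<open>[0,T]\<close>
  (and the left limits at times in \<open>(0,T]\<close>) play a role.\<close>

type_synonym 'a process = "real \<Rightarrow> 'a \<Rightarrow> real"

definition filtered_prob_space :: "'a measure \<Rightarrow> (real \<Rightarrow> 'a measure) \<Rightarrow> real \<Rightarrow> bool" where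
  "filtered_prob_space P F T \<longleftrightarrow>
     prob_space P \<and> 0 < T \<and> filtration (space P) F \<and> (\<forall>t. subalgebra P (F t))"

definition adapted :: "(real \<Rightarrow> 'a measure) \<Rightarrow> real \<Rightarrow> 'a process \<Rightarrow> bool" where
  "adapted F T X \<longleftrightarrow> (\<forall>t\<in>{0..T}. X t \<in> borel_measurable (F t))"

definition cadlag_on :: "real \<Rightarrow> (real \<Rightarrow> real) \<Rightarrow> bool" where
  "cadlag_on T f \<longleftrightarrow>
     (\<forall>t\<in>{0..<T}. (f \<longlongrightarrow> f t) (at_right t)) \<and>
     (\<forall>t\<in>{0<..T}. \<exists>l. (f \<longlongrightarrow> l) (at_left t))"

definition caglad_on :: "real \<Rightarrow> (real \<Rightarrow> real) \<Rightarrow> bool" where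
  "caglad_on T f \<longleftrightarrow>
     (\<forall>t\<in>{0<..T}. (f \<longlongrightarrow> f t) (at_left t)) \<and>
     (\<forall>t\<in>{0..<T}. \<exists>l. (f \<longlongrightarrow> l) (at_right t))"

definition adapted_cadlag :: "'a measure \<Rightarrow> (real \<Rightarrow> 'a measure) \<Rightarrow> real \<Rightarrow> 'a process \<Rightarrow> bool" where
  "adapted_cadlag P F T X \<longleftrightarrow> adapted F T X \<and> (\<forall>\<omega>\<in>space P. cadlag_on T (\<lambda>t. X t \<omega>))"

text \<open>The class of integrands on \<open>(0,T]\<close>; the value at time \<open>0\<close> is irrelevant.\<close>

definition adapted_caglad :: "'a measure \<Rightarrow> (real \<Rightarrow> 'a measure) \<Rightarrow> real \<Rightarrow> 'a process \<Rightarrow> bool" where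
  "adapted_caglad P F T H \<longleftrightarrow>
     (\<forall>t\<in>{0<..T}. H t \<in> borel_measurable (F t)) \<and> (\<forall>\<omega>\<in>space P. caglad_on T (\<lambda>t. H t \<omega>))"

definition left_limit :: "'a process \<Rightarrow> 'a process" where
  "left_limit X t \<omega> = Lim (at_left t) (\<lambda>s. X s \<omega>)"

definition jump :: "'a process \<Rightarrow> 'a process" where
  "jump X t \<omega> = X t \<omega> - left_limit X t \<omega>"

section \<open>Semimartingales\<close>

definition martingale_on :: "'a measure \<Rightarrow> (real \<Rightarrow> 'a measure) \<Rightarrow> real \<Rightarrow> 'a process \<Rightarrow> bool" where
  "martingale_on P F T X \<longleftrightarrow>
     adapted F T X \<and> (\<forall>t\<in>{0..T}. integrable P (X t)) \<and>
     (\<forall>s t. 0 \<le> s \<and> s \<le> t \<and> t \<le> T \<longrightarrow> (AE \<omega> in P. real_cond_exp P (F s) (X t) \<omega> = X s \<omega>))"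

text \<open>On the closed horizon \<open>[0,T]\<close> a localizing sequence is one that almost surely
  eventually reaches \<open>T\<close>.\<close>

definition local_martingale_on :: "'a measure \<Rightarrow> (real \<Rightarrow> 'a measure) \<Rightarrow> real \<Rightarrow> 'a process \<Rightarrow> bool" where
  "local_martingale_on P F T X \<longleftrightarrow>
     adapted_cadlag P F T X \<and>
     (\<exists>\<tau> :: nat \<Rightarrow> 'a \<Rightarrow> real.
        (\<forall>n. stopping_time F (\<tau> n)) \<and>
        (\<forall>n. \<forall>\<omega>\<in>space P. 0 \<le> \<tau> n \<omega> \<and> \<tau> n \<omega> \<le> \<tau> (Suc n) \<omega> \<and> \<tau> n \<omega> \<le> T) \<and>
        (AE \<omega> in P. \<exists>n. \<tau> n \<omega> = T) \<and>
        (\<forall>n. martingale_on P F T (\<lambda>t \<omega>. X (min t (\<tau> n \<omega>)) \<omega> - X 0 \<omega>)))"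

definition finite_variation_on :: "real \<Rightarrow> (real \<Rightarrow> real) \<Rightarrow> bool" where
  "finite_variation_on T f \<longleftrightarrow>
     (\<exists>B. \<forall>(n::nat) r. 0 \<le> r 0 \<and> (\<forall>i<n. r i \<le> r (Suc i)) \<and> r n \<le> T \<longrightarrow>
        (\<Sum>i<n. \<bar>f (r (Suc i)) - f (r i)\<bar>) \<le> B)"

definition semimartingale :: "'a measure \<Rightarrow> (real \<Rightarrow> 'a measure) \<Rightarrow> real \<Rightarrow> 'a process \<Rightarrow> bool" where
  "semimartingale P F T X \<longleftrightarrow>
     adapted_cadlag P F T X \<and>
     (\<exists>L A. local_martingale_on P F T L \<and>
        adapted_cadlag P F T A \<and> (\<forall>\<omega>\<in>space P. finite_variation_on T (\<lambda>t. A t \<omega>)) \<and>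
        (AE \<omega> in P. \<forall>t\<in>{0..T}. X t \<omega> = X 0 \<omega> + L t \<omega> + A t \<omega>))"

section \<open>The stochastic integral\<close>

text \<open>An elementary predictable process \<open>\<Sum>i<n. \<xi>\<^sub>i 1\<^bsub>(r\<^sub>i, r\<^sub>i\<^sub>+\<^sub>1]\<^esub>\<close> is given by \<open>(n, r, \<xi>)\<close>.\<close>

definition elementary :: "'a measure \<Rightarrow> (real \<Rightarrow> 'a measure) \<Rightarrow> real \<Rightarrow>
    nat \<Rightarrow> (nat \<Rightarrow> real) \<Rightarrow> (nat \<Rightarrow> 'a \<Rightarrow> real) \<Rightarrow> bool" where
  "elementary P F T n r \<xi> \<longleftrightarrow>
     0 \<le> r 0 \<and> (\<forall>i<n. r i \<le> r (Suc i)) \<and> r n \<le> T \<and>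
     (\<forall>i<n. \<xi> i \<in> borel_measurable (F (r i)) \<and> (\<exists>B. \<forall>\<omega>\<in>space P. \<bar>\<xi> i \<omega>\<bar> \<le> B))"

definition elementary_process :: "nat \<Rightarrow> (nat \<Rightarrow> real) \<Rightarrow> (nat \<Rightarrow> 'a \<Rightarrow> real) \<Rightarrow> 'a process" where
  "elementary_process n r \<xi> u \<omega> = (\<Sum>i<n. \<xi> i \<omega> * indicator {r i<..r (Suc i)} u)"

definition elementary_integral ::
    "nat \<Rightarrow> (nat \<Rightarrow> real) \<Rightarrow> (nat \<Rightarrow> 'a \<Rightarrow> real) \<Rightarrow> 'a process \<Rightarrow> 'a process" where
  "elementary_integral n r \<xi> X t \<omega> =
     (\<Sum>i<n. \<xi> i \<omega> * (X (min (r (Suc i)) t) \<omega> - X (min (r i) t) \<omega>))"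

text \<open>Convergence uniformly on \<open>[0,T]\<close> in probability.\<close>

definition ucp_tendsto :: "'a measure \<Rightarrow> real \<Rightarrow> (nat \<Rightarrow> 'a process) \<Rightarrow> 'a process \<Rightarrow> bool" where
  "ucp_tendsto P T J U \<longleftrightarrow>
     (\<forall>\<epsilon>>0. (\<lambda>k. measure P {\<omega>\<in>space P. \<exists>t\<in>{0..T}. \<bar>J k t \<omega> - U t \<omega>\<bar> > \<epsilon>}) \<longlonglongrightarrow> 0)"

text \<open>\<open>ito_integral P F T H X U\<close>: the process \<open>U\<close> is (a version of) the It\^o integral
  \<open>U\<^sub>t = \<integral>\<^bsub>(0,t]\<^esub> H\<^sub>u dX\<^sub>u\<close> of the adapted caglad process \<open>H\<close> with respect to the semimartingale \<open>X\<close>.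
  The integral is the unique extension of the elementary integral that satisfies the dominated
  convergence theorem (Jacod-Shiryaev, Theorem I.4.31; Bichteler): whenever elementary predictable
  processes converge pointwise to \<open>H\<close> and are dominated by one adapted caglad (hence locally
  bounded predictable) process, their elementary integrals converge to \<open>U\<close>. Such sequences
  always exist (truncated left-point sums over deterministic grids), so \<open>U\<close> is determined up to
  indistinguishability. It is a relation because integrals are only defined up to that
  equivalence.\<close>

definition ito_integral :: "'a measure \<Rightarrow> (real \<Rightarrow> 'a measure) \<Rightarrow> real \<Rightarrow>
    'a process \<Rightarrow> 'a process \<Rightarrow> 'a process \<Rightarrow> bool" where
  "ito_integral P F T H X U \<longleftrightarrow>
     semimartingale P F T X \<and> adapted_caglad P F T H \<and> adapted_cadlag P F T U \<and>
     (\<forall>n r \<xi> G.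
        (\<forall>k. elementary P F T (n k) (r k) (\<xi> k)) \<and>
        adapted_caglad P F T G \<and>
        (\<forall>k. \<forall>u\<in>{0<..T}. \<forall>\<omega>\<in>space P. \<bar>elementary_process (n k) (r k) (\<xi> k) u \<omega>\<bar> \<le> G u \<omega>) \<and>
        (\<forall>u\<in>{0<..T}. \<forall>\<omega>\<in>space P.
           (\<lambda>k. elementary_process (n k) (r k) (\<xi> k) u \<omega>) \<longlonglongrightarrow> H u \<omega>) \<longrightarrow>
        ucp_tendsto P T (\<lambda>k. elementary_integral (n k) (r k) (\<xi> k) X) U)"

text \<open>\<open>[X,Y] = XY - X\<^sub>0Y\<^sub>0 - \<integral>X\<^sub>- dY - \<integral>Y\<^sub>- dX\<close>, normalised to start at \<open>0\<close>.\<close>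

definition quadratic_covariation :: "'a measure \<Rightarrow> (real \<Rightarrow> 'a measure) \<Rightarrow> real \<Rightarrow>
    'a process \<Rightarrow> 'a process \<Rightarrow> 'a process \<Rightarrow> bool" where
  "quadratic_covariation P F T X Y C \<longleftrightarrow>
     adapted_cadlag P F T C \<and>
     (\<exists>U V. ito_integral P F T (left_limit X) Y U \<and> ito_integral P F T (left_limit Y) X V \<and>
        (AE \<omega> in P. \<forall>t\<in>{0..T}. C t \<omega> = X t \<omega> * Y t \<omega> - X 0 \<omega> * Y 0 \<omega> - U t \<omega> - V t \<omega>))"

definition continuous_covariation :: "'a measure \<Rightarrow> (real \<Rightarrow> 'a measure) \<Rightarrow> real \<Rightarrow>
    'a process \<Rightarrow> 'a process \<Rightarrow> 'a process \<Rightarrow> bool" where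
  "continuous_covariation P F T X Y D \<longleftrightarrow>
     adapted_cadlag P F T D \<and>
     (\<exists>C. quadratic_covariation P F T X Y C \<and>
        (AE \<omega> in P. \<forall>t\<in>{0..T}.
           D t \<omega> = C t \<omega> - (\<Sum>\<^sub>\<infinity>u\<in>{0<..t}. jump X u \<omega> * jump Y u \<omega>)))"

section \<open>Tensors and signatures\<close>

text \<open>Multi-indices are words over an alphabet. An element of the extended tensor algebra is
  represented by its coordinates, i.e. a function on words; an element of the tensor algebra is a
  finitely supported one. Tensor products of basis elements are concatenations of words.\<close>

type_synonym 'i tensor = "'i list \<Rightarrow>\<^sub>0 real"

definition eps :: "'i list \<Rightarrow> 'i tensor" where
  "eps J = Poly_Mapping.single J 1"

definition scale :: "real \<Rightarrow> 'i tensor \<Rightarrow> 'i tensor" where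
  "scale c u = Poly_Mapping.map (\<lambda>x. c * x) u"

definition pairing :: "'i tensor \<Rightarrow> ('i list \<Rightarrow> real) \<Rightarrow> real" where
  "pairing u x = (\<Sum>J\<in>Poly_Mapping.keys u. Poly_Mapping.lookup u J * x J)"

definition splits :: "'i list \<Rightarrow> ('i list \<times> 'i list) set" where
  "splits J = {(J1, J2). J1 @ J2 = J}"

text \<open>\<open>is_signature P F T A X Sig\<close>: the family \<open>Sig\<close>, indexed by the words over the finite alphabet
  \<open>A\<close>, is (a version of) the signature of the semimartingale \<open>X = (X\<^sup>i)\<^bsub>i\<in>A\<^esub>\<close>.
  Here \<open>J' = butlast J\<close> and \<open>J'' = butlast (butlast J)\<close>.\<close>

definition is_signature :: "'a measure \<Rightarrow> (real \<Rightarrow> 'a measure) \<Rightarrow> real \<Rightarrow>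
    'i set \<Rightarrow> ('i \<Rightarrow> 'a process) \<Rightarrow> ('i list \<Rightarrow> 'a process) \<Rightarrow> bool" where
  "is_signature P F T A X Sig \<longleftrightarrow>
     (\<forall>i\<in>A. semimartingale P F T (X i)) \<and>
     (\<forall>J\<in>lists A. adapted_cadlag P F T (Sig J)) \<and>
     (\<forall>t\<in>{0..T}. \<forall>\<omega>\<in>space P. Sig [] t \<omega> = 1) \<and>
     (\<forall>J\<in>lists A. J \<noteq> [] \<longrightarrow>
        (\<exists>U V.
           ito_integral P F T (left_limit (Sig (butlast J))) (X (last J)) U \<and>
           (if length J > 1
            then \<exists>D. continuous_covariation P F T (X (last (butlast J))) (X (last J)) D \<and>
                     ito_integral P F T (left_limit (Sig (butlast (butlast J)))) D V
            else V = (\<lambda>_ _. 0)) \<and>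
           (AE \<omega> in P. \<forall>t\<in>{0..T}.
              Sig J t \<omega> = U t \<omega> + 1 / 2 * V t \<omega>
                + (\<Sum>\<^sub>\<infinity>u\<in>{0<..t}. \<Sum>(J1, J2)\<in>splits J.
                     1 / fact (length J2) * of_bool (length J2 > 1) *
                     left_limit (Sig J1) u \<omega> * (\<Prod>j\<leftarrow>J2. jump (X j) u \<omega>)))))"

section \<open>The state process\<close>

definition counting_process :: "'a measure \<Rightarrow> (real \<Rightarrow> 'a measure) \<Rightarrow> real \<Rightarrow> 'a process \<Rightarrow> bool" where
  "counting_process P F T N \<longleftrightarrow>
     adapted_cadlag P F T N \<and>
     (\<forall>\<omega>\<in>space P.
        N 0 \<omega> = 0 \<and>
        (\<forall>t\<in>{0..T}. N t \<omega> \<in> \<nat>) \<and>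
        (\<forall>s t. 0 \<le> s \<and> s \<le> t \<and> t \<le> T \<longrightarrow> N s \<omega> \<le> N t \<omega>) \<and>
        (\<forall>t\<in>{0..T}. N t \<omega> = (\<Sum>\<^sub>\<infinity>u\<in>{0<..t}. jump N u \<omega>)))"

text \<open>\<open>Time, Mid, QV\<close> are the letters \<open>0, s, qs\<close>, and \<open>Ask m, Bid m\<close> are \<open>a\<^sup>m, b\<^sup>m\<close>, with
  \<open>a = a\<^sup>1\<close> and \<open>b = b\<^sup>1\<close>.\<close>

datatype letter = Time | Mid | QV | Ask nat | Bid nat

definition alphabet :: "nat \<Rightarrow> letter set" where
  "alphabet M = {Time, Mid, QV} \<union> Ask ` {1..M} \<union> Bid ` {1..M}"

definition base_alphabet :: "letter set" where
  "base_alphabet = {Time, Mid, Ask 1, Bid 1}"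

definition jump_power_sum :: "nat \<Rightarrow> 'a process \<Rightarrow> 'a process" where
  "jump_power_sum m N t \<omega> = (\<Sum>\<^sub>\<infinity>u\<in>{0<..t}. jump N u \<omega> ^ m)"

text \<open>\<open>QS\<close> is a version of the quadratic variation of \<open>S\<close>.\<close>

fun state_process :: "'a process \<Rightarrow> 'a process \<Rightarrow> 'a process \<Rightarrow> 'a process \<Rightarrow> letter \<Rightarrow> 'a process" where
  "state_process S QS Na Nb Time = (\<lambda>t \<omega>. t)"
| "state_process S QS Na Nb Mid = S"
| "state_process S QS Na Nb QV = QS"
| "state_process S QS Na Nb (Ask m) = (if m = 1 then Na else jump_power_sum m Na)"
| "state_process S QS Na Nb (Bid m) = (if m = 1 then Nb else jump_power_sum m Nb)"

section \<open>The tilde transform\<close>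

definition compositions :: "nat \<Rightarrow> nat \<Rightarrow> nat list set" where
  "compositions r k = {is. length is = k \<and> (\<forall>i\<in>set is. i \<ge> 1) \<and> sum_list is = r}"

definition alpha2 :: "nat \<Rightarrow> nat \<Rightarrow> real" where
  "alpha2 r k = (\<Sum>is\<in>compositions r k. \<Prod>i\<leftarrow>is. 1 / fact (i + 1))"

definition alpha :: "nat \<Rightarrow> real" where
  "alpha r = (\<Sum>k=1..r. (-1) ^ k * alpha2 r k)"

definition tilde_word :: "letter list \<Rightarrow> letter \<Rightarrow> letter tensor" where
  "tilde_word J j =
     eps (J @ [j])
     - (if J \<noteq> [] \<and> last J = Mid \<and> j = Mid then scale (1 / 2) (eps (butlast J @ [QV])) else 0)
     + (\<Sum>(J1, J2)\<in>{(J1, J2)\<in>splits J. J2 \<noteq> []}.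
          if j = Ask 1 \<and> set J2 = {Ask 1}
          then scale (alpha (length J2)) (eps (J1 @ [Ask (length J2 + 1)])) else 0)
     + (\<Sum>(J1, J2)\<in>{(J1, J2)\<in>splits J. J2 \<noteq> []}.
          if j = Bid 1 \<and> set J2 = {Bid 1}
          then scale (alpha (length J2)) (eps (J1 @ [Bid (length J2 + 1)])) else 0)"

definition tilde :: "letter tensor \<Rightarrow> letter \<Rightarrow> letter tensor" where
  "tilde u j = (\<Sum>J\<in>Poly_Mapping.keys u. scale (Poly_Mapping.lookup u J) (tilde_word J j))"

section \<open>Signature-linear offsets, execution revenue and inventory profit-and-loss\<close>

definition sig_coeffs :: "nat \<Rightarrow> letter tensor set" where
  "sig_coeffs K = {u. \<forall>J\<in>Poly_Mapping.keys u. length J \<le> K \<and> set J \<subseteq> base_alphabet}"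

definition sig_linear :: "letter tensor \<Rightarrow> (letter list \<Rightarrow> 'a process) \<Rightarrow> 'a process" where
  "sig_linear u Sig t \<omega> = pairing u (\<lambda>J. Sig J t \<omega>)"

definition execution_revenue :: "'a measure \<Rightarrow> (real \<Rightarrow> 'a measure) \<Rightarrow> real \<Rightarrow>
    'a process \<Rightarrow> 'a process \<Rightarrow> 'a process \<times> 'a process \<Rightarrow> 'a process \<Rightarrow> bool" where
  "execution_revenue P F T Na Nb \<delta> Z \<longleftrightarrow>
     (\<exists>Za Zb. ito_integral P F T (left_limit (fst \<delta>)) Na Za \<and>
              ito_integral P F T (left_limit (snd \<delta>)) Nb Zb \<and>
              (AE \<omega> in P. \<forall>t\<in>{0..T}. Z t \<omega> = Za t \<omega> + Zb t \<omega>))"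

text \<open>\<open>I = \<integral> Q dS\<close> with \<open>Q = N\<^sup>b - N\<^sup>a\<close>. The cadlag inventory is not predictable; it is
  integrated, as usual, through its left-limit process, which differs from it at countably many
  times only and hence gives the same integral with respect to the continuous process \<open>S\<close>.\<close>

definition inventory :: "'a process \<Rightarrow> 'a process \<Rightarrow> 'a process" where
  "inventory Na Nb t \<omega> = Nb t \<omega> - Na t \<omega>"

definition inventory_pnl :: "'a measure \<Rightarrow> (real \<Rightarrow> 'a measure) \<Rightarrow> real \<Rightarrow>
    'a process \<Rightarrow> 'a process \<Rightarrow> 'a process \<Rightarrow> 'a process \<Rightarrow> bool" where
  "inventory_pnl P F T Na Nb S I \<longleftrightarrow> ito_integral P F T (left_limit (inventory Na Nb)) S I"

end

theory Submission
  imports Defs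
begin

text \<open>Every stochastic integral that has to be computed contains a pure-jump process, either as integrator
  or as integrand. A counting process has finitely many jumps on each path, and left-point Riemann
  sums along such a path are finite sums over the jump times which converge path by path:
  \<open>\<integral>\<^sub>0\<^sup>t H dN = \<Sum>\<^sub>v\<^sub>\<le>\<^sub>t H\<^sub>v \<Delta>N\<^sub>v\<close> (\<open>ito_integral_pure_jump_integrator\<close>) and
  \<open>\<integral>\<^sub>0\<^sup>t N\<^sub>- dX = \<Sum>\<^sub>v\<^sub>\<le>\<^sub>t \<Delta>N\<^sub>v (X\<^sub>t - X\<^sub>v)\<close> (\<open>ito_integral_pure_jump_integrand\<close>). Inserting both into the
  definition of the bracket shows that the continuous covariation with a pure-jump process vanishes
  (\<open>continuous_covariation_pure_jump\<close>).

  Hence the signature coordinate of \<open>J a\<^sup>m\<close>, for a word \<open>J\<close> of base letters, where \<open>a\<^sup>m\<close> denotes the single letter of the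
  \<open>m\<close>-th jump power sum, is a finite sum over the jump times \<open>v\<close> of \<open>N\<^sup>a\<close>. At such a time no other base
  letter jumps, so only the factorisations \<open>J = J\<^sub>1 a\<dots>a\<close> with \<open>k \<ge> 0\<close> trailing letters \<open>a\<close>
  contribute, namely \<open>Sig J\<^sub>1 (v-) \<cdot> (\<Delta>N\<^sub>v)\<^sup>k\<^sup>+\<^sup>m / (k + 1)!\<close>. The execution revenue of \<open>\<epsilon>\<^sub>J\<close> only has the
  term \<open>Sig J (v-) \<cdot> \<Delta>N\<^sub>v\<close>. The tilde transform removes the terms with \<open>k > 0\<close>: its coefficients, together
  with \<open>1\<close> for the empty suffix, are those of \<open>x / (e\<^sup>x - 1)\<close>, the reciprocal of
  \<open>\<Sum>\<^sub>k x\<^sup>k / (k + 1)!\<close> (\<open>alpha0_convolution\<close>), and coassociativity of deconcatenation turns the double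
  sum over factorisations into this convolution (\<open>ito_integral_signature_tilde\<close>). Linearity in the
  offset is then that of finite sums (\<open>sig_linear_execution_leg\<close>).

  For the inventory, \<open>\<integral> Q\<^sub>- dS\<close> and the coordinates of \<open>b s\<close> and \<open>a s\<close> are all integrals of pure-jump
  integrands against the continuous mid-price, so both sides equal the same sum of
  \<open>\<Delta>Q\<^sub>v (S\<^sub>t - S\<^sub>v)\<close> over jump times.\<close>

section \<open>One-sided limits of paths\<close>

lemma cadlag_tendsto_from_right:
  assumes "cadlag_on T f" "0 \<le> s" "\<And>k. s \<le> r k" "\<And>k. r k \<le> T" "r \<longlonglongrightarrow> s"
  shows "(\<lambda>k. f (r k)) \<longlonglongrightarrow> f s"
proof (cases "s < T")
  case True
  then have "(f \<longlongrightarrow> f s) (at_right s)"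
    using assms(1,2) unfolding cadlag_on_def by auto
  moreover have "at s within {s..} = at_right s"
    unfolding at_within_def by (rule arg_cong[where f="\<lambda>A. inf (nhds s) (principal A)"]) auto
  ultimately have "continuous (at s within {s..}) f"
    unfolding continuous_within by simp
  then show ?thesis
    by (rule continuous_within_tendsto_compose') (use assms in auto)
next
  case False
  then have "r k = s" for k
    using assms(3)[of k] assms(4)[of k] by linarith
  then show ?thesis by simp
qed

lemma left_limit_tendsto:
  assumes "cadlag_on T (\<lambda>t. X t \<omega>)" "u \<in> {0<..T}"
  shows "((\<lambda>s. X s \<omega>) \<longlongrightarrow> left_limit X u \<omega>) (at_left u)"
  using assms unfolding cadlag_on_def left_limit_def
  by (metis tendsto_Lim trivial_limit_at_left_real)

lemma left_limitI:
  assumes "((\<lambda>s. X s \<omega>) \<longlongrightarrow> l) (at_left u)"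
  shows "left_limit X u \<omega> = l"
  unfolding left_limit_def using assms by (simp add: tendsto_Lim)

text \<open>Near every point of \<open>[0, T]\<close> the one-sided limits bound \<open>f\<close>, and local bounds combine by the
  bisection principle.\<close>

lemma caglad_bounded:
  assumes c: "caglad_on T f"
  obtains B where "\<And>s. s \<in> {0<..T} \<Longrightarrow> \<bar>f s\<bar> \<le> B"
proof (cases "0 \<le> T")
  case True
  let ?P = "\<lambda>a b. \<exists>B. \<forall>s\<in>{a..b} \<inter> {0<..T}. \<bar>f s\<bar> \<le> B"
  have "?P 0 T"
  proof (rule Bolzano[of 0 T ?P])
    fix a b c assume "?P a b" "?P b c" "a \<le> b" "b \<le> c"
    then obtain B1 B2 where "\<forall>s\<in>{a..b} \<inter> {0<..T}. \<bar>f s\<bar> \<le> B1" "\<forall>s\<in>{b..c} \<inter> {0<..T}. \<bar>f s\<bar> \<le> B2"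
      by blast
    then have "\<bar>f s\<bar> \<le> max B1 B2" if "s \<in> {a..c} \<inter> {0<..T}" for s
      using that by (cases "s \<le> b") (auto simp: le_max_iff_disj)
    then show "?P a c" by blast
  next
    fix x assume x: "0 \<le> x" "x \<le> T"
    have L: "\<exists>B d. 0 < d \<and> (\<forall>s. 0 < s \<and> x - d < s \<and> s < x \<longrightarrow> \<bar>f s\<bar> \<le> B)"
    proof (cases "x = 0")
      case True then show ?thesis by (intro exI[of _ 1]) auto
    next
      case False
      then have "(f \<longlongrightarrow> f x) (at_left x)" using c x unfolding caglad_on_def by auto
      then have "eventually (\<lambda>s. dist (f s) (f x) < 1) (at_left x)"
        by (rule tendstoD) simp
      then obtain b where b: "b < x" "\<forall>y>b. y < x \<longrightarrow> dist (f y) (f x) < 1"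
        unfolding eventually_at_left_field by blast
      have "\<bar>f s\<bar> \<le> \<bar>f x\<bar> + 1" if "x - (x - b) < s" "s < x" for s
        using b(2)[rule_format, of s] that by (auto simp: dist_real_def)
      then show ?thesis using b(1) by (intro exI[of _ "\<bar>f x\<bar> + 1"] exI[of _ "x - b"]) auto
    qed
    have R: "\<exists>B d. 0 < d \<and> (\<forall>s. s \<le> T \<and> x < s \<and> s < x + d \<longrightarrow> \<bar>f s\<bar> \<le> B)"
    proof (cases "x = T")
      case True then show ?thesis by (intro exI[of _ 1]) auto
    next
      case False
      then obtain l where "(f \<longlongrightarrow> l) (at_right x)" using c x unfolding caglad_on_def by force
      then have "eventually (\<lambda>s. dist (f s) l < 1) (at_right x)"
        by (rule tendstoD) simp
      then obtain b where b: "x < b" "\<forall>y>x. y < b \<longrightarrow> dist (f y) l < 1"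
        unfolding eventually_at_right_field by blast
      have "\<bar>f s\<bar> \<le> \<bar>l\<bar> + 1" if "s < x + (b - x)" "x < s" for s
        using b(2)[rule_format, of s] that by (auto simp: dist_real_def)
      then show ?thesis using b(1) by (intro exI[of _ "\<bar>l\<bar> + 1"] exI[of _ "b - x"]) auto
    qed
    obtain B1 d1 where 1: "0 < d1" "\<And>s. 0 < s \<Longrightarrow> x - d1 < s \<Longrightarrow> s < x \<Longrightarrow> \<bar>f s\<bar> \<le> B1" using L by blast
    obtain B2 d2 where 2: "0 < d2" "\<And>s. s \<le> T \<Longrightarrow> x < s \<Longrightarrow> s < x + d2 \<Longrightarrow> \<bar>f s\<bar> \<le> B2" using R by blast
    show "\<exists>d>0. \<forall>a b. a \<le> x \<and> x \<le> b \<and> b - a < d \<longrightarrow> ?P a b"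
    proof (rule exI[of _ "min d1 d2"], rule conjI[rotated], rule allI, rule allI, rule impI)
      fix a b assume ab: "a \<le> x \<and> x \<le> b \<and> b - a < min d1 d2"
      have "\<bar>f s\<bar> \<le> max \<bar>f x\<bar> (max B1 B2)" if s: "s \<in> {a..b} \<inter> {0<..T}" for s
      proof -
        consider "s < x" | "s = x" | "x < s" by linarith
        then show ?thesis
        proof cases
          case 1 then show ?thesis using 1 s ab \<open>\<And>s. 0 < s \<Longrightarrow> x - d1 < s \<Longrightarrow> s < x \<Longrightarrow> \<bar>f s\<bar> \<le> B1\<close>[of s]
            by auto
        next
          case 3 then show ?thesis using 2(2)[of s] s ab by auto
        qed auto
      qed
      then show "?P a b" by blast
    qed (use 1 2 in auto)
  qed (use True in auto)
  then show ?thesis using that by (meson IntI atLeastAtMost_iff greaterThanAtMost_iff less_imp_le)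
next
  case False then show ?thesis using that[of 0] by auto
qed

section \<open>Left-point approximations\<close>

text \<open>The elementary approximation of a caglad integrand \<open>H\<close> takes its values at the left end points of
  \<open>k + 1\<close> equal cells of \<open>[0, T]\<close>. The clipping at \<open>k\<close> makes them bounded, as elementary processes must
  be, and is eventually inactive on each path. On the first cell the value is \<open>0\<close> because an integrand
  is only adapted at positive times.\<close>

definition grid :: "real \<Rightarrow> nat \<Rightarrow> nat \<Rightarrow> real" where
  "grid T k i = T * real i / real (k + 1)"

definition left_point :: "real \<Rightarrow> 'a process \<Rightarrow> nat \<Rightarrow> nat \<Rightarrow> 'a \<Rightarrow> real" where
  "left_point T H k i \<omega> =
     (if i = 0 then 0 else max (- real k) (min (real k) (H (grid T k i) \<omega>)))"

text \<open>The running supremum of \<open>\<bar>H\<bar>\<close> over \<open>(0, u)\<close>, which dominates all left-point approximations at once.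
  Restricting it to rational times keeps it measurable and, by left-continuity of \<open>H\<close>, does not change
  its value.\<close>

definition sup_process :: "'a process \<Rightarrow> 'a process" where
  "sup_process H u \<omega> = (SUP q\<in>{q\<in>\<rat>. 0 < q \<and> q < u}. \<bar>H q \<omega>\<bar>)"

lemma grid_mono: "0 < T \<Longrightarrow> i \<le> j \<Longrightarrow> grid T k i \<le> grid T k j"
  unfolding grid_def by (intro divide_right_mono mult_left_mono) auto

lemma grid_0 [simp]: "grid T k 0 = 0" and grid_last [simp]: "grid T k (Suc k) = T"
  by (simp_all add: grid_def)

lemma grid_bounds: "0 < T \<Longrightarrow> i \<le> Suc k \<Longrightarrow> grid T k i \<in> {0..T}"
  using grid_mono[of T 0 i k] grid_mono[of T i "Suc k" k] by auto

lemma grid_Suc_diff: "grid T k (Suc i) - grid T k i = T / real (k + 1)"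
  unfolding grid_def by (simp add: diff_divide_distrib[symmetric] right_diff_distrib[symmetric])

text \<open>Locates the first grid point strictly to the right of \<open>v\<close>; this is where the left-point
  approximation first sees a jump that \<open>H\<close> makes just after \<open>v\<close>.\<close>

lemma less_grid_iff:
  assumes "0 < T" "0 \<le> v"
  shows "v < grid T k i \<longleftrightarrow> Suc (nat \<lfloor>v * real (k + 1) / T\<rfloor>) \<le> i"
proof -
  have "v < grid T k i \<longleftrightarrow> v * real (k + 1) / T < real i"
    using assms unfolding grid_def by (simp add: field_simps)
  also have "\<dots> \<longleftrightarrow> \<lfloor>v * real (k + 1) / T\<rfloor> < int i"
    by (metis floor_less_iff of_int_of_nat_eq)
  also have "\<dots> \<longleftrightarrow> Suc (nat \<lfloor>v * real (k + 1) / T\<rfloor>) \<le> i"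
    using assms by (auto simp: Suc_le_eq zless_nat_conj nat_less_iff)
  finally show ?thesis .
qed

lemma elementary_process_at:
  assumes "0 < T" "u \<in> {0<..T}"
  obtains i where "i \<le> k" "grid T k i < u" "u \<le> grid T k (Suc i)"
    and "\<And>\<xi> \<omega>. elementary_process (Suc k) (grid T k) \<xi> u \<omega> = \<xi> i \<omega>"
proof -
  define i where "i = (LEAST i. u \<le> grid T k (Suc i))"
  have ex: "u \<le> grid T k (Suc k)" using assms by simp
  have i1: "u \<le> grid T k (Suc i)" unfolding i_def by (rule LeastI[where P="\<lambda>i. u \<le> grid T k (Suc i)", OF ex])
  have ik: "i \<le> k" unfolding i_def by (rule Least_le[where P="\<lambda>i. u \<le> grid T k (Suc i)", OF ex])
  have i0: "grid T k i < u"
  proof (cases i)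
    case 0 then show ?thesis using assms by simp
  next
    case (Suc j) then show ?thesis using not_less_Least[of j "\<lambda>i. u \<le> grid T k (Suc i)"] i_def by auto
  qed
  have uniq: "j = i" if "grid T k j < u" "u \<le> grid T k (Suc j)" for j
  proof (rule ccontr)
    assume "j \<noteq> i"
    then consider "Suc j \<le> i" | "Suc i \<le> j" by linarith
    then show False
      using grid_mono[OF assms(1), of "Suc j" i k] grid_mono[OF assms(1), of "Suc i" j k] that i0 i1
      by cases auto
  qed
  have "elementary_process (Suc k) (grid T k) \<xi> u \<omega> = \<xi> i \<omega>" for \<xi> \<omega>
  proof -
    have "elementary_process (Suc k) (grid T k) \<xi> u \<omega> = (\<Sum>j<Suc k. if j = i then \<xi> i \<omega> else 0)"
      unfolding elementary_process_def
    proof (rule sum.cong)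
      fix j show "\<xi> j \<omega> * indicator {grid T k j<..grid T k (Suc j)} u = (if j = i then \<xi> i \<omega> else 0)"
      proof (cases "j = i")
        case True then show ?thesis using i0 i1 by simp
      next
        case False then show ?thesis using uniq[of j] by (auto simp: indicator_def)
      qed
    qed simp
    also have "\<dots> = \<xi> i \<omega>"
      by (rule trans[OF sum.delta]) (use ik in auto)
    finally show ?thesis .
  qed
  then show ?thesis using that ik i0 i1 by blast
qed

lemma abs_left_point_le: "\<bar>left_point T H k i \<omega>\<bar> \<le> (if i = 0 then 0 else \<bar>H (grid T k i) \<omega>\<bar>)"
  unfolding left_point_def by auto

lemma elementary_left_point:
  assumes fps: "filtered_prob_space P F T" and H: "adapted_caglad P F T H"
  shows "elementary P F T (Suc k) (grid T k) (left_point T H k)"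
proof -
  have T: "0 < T" and F: "subalgebra P (F t)" for t using fps unfolding filtered_prob_space_def by auto
  have "left_point T H k i \<in> borel_measurable (F (grid T k i))" if "i < Suc k" for i
  proof (cases "i = 0")
    case False
    then have "0 < grid T k i" using T by (simp add: grid_def)
    then have "H (grid T k i) \<in> borel_measurable (F (grid T k i))"
      using H that grid_bounds[OF T, of i k] unfolding adapted_caglad_def by auto
    then show ?thesis unfolding left_point_def using False by simp
  qed (simp add: left_point_def[abs_def])
  moreover have "\<exists>B. \<forall>\<omega>\<in>space P. \<bar>left_point T H k i \<omega>\<bar> \<le> B" for i
    by (rule exI[of _ "real k"]) (auto simp: left_point_def)
  ultimately show ?thesis
    unfolding elementary_def using grid_mono[OF T] by auto
qed

lemma left_point_tendsto:
  assumes T: "0 < T" and H: "caglad_on T (\<lambda>t. H t \<omega>)" and u: "u \<in> {0<..T}"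
  shows "(\<lambda>k. elementary_process (Suc k) (grid T k) (left_point T H k) u \<omega>) \<longlonglongrightarrow> H u \<omega>"
proof -
  have "\<forall>k. \<exists>i. i \<le> k \<and> grid T k i < u \<and> u \<le> grid T k (Suc i) \<and>
    elementary_process (Suc k) (grid T k) (left_point T H k) u \<omega> = left_point T H k i \<omega>"
    using elementary_process_at[OF T u] by metis
  then obtain i where i: "\<And>k. grid T k (i k) < u" "\<And>k. u \<le> grid T k (Suc (i k))"
    "\<And>k. elementary_process (Suc k) (grid T k) (left_point T H k) u \<omega> = left_point T H k (i k) \<omega>"
    by metis
  let ?r = "\<lambda>k. grid T k (i k)"
  have mesh: "(\<lambda>k. T / real (k + 1)) \<longlonglongrightarrow> 0"
    using LIMSEQ_Suc[OF lim_const_over_n[of T]] by simp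
  have r: "?r \<longlonglongrightarrow> u"
  proof (rule tendsto_sandwich[of "\<lambda>k. u - T / real (k + 1)" _ _ "\<lambda>k. u"])
    show "(\<lambda>k. u - T / real (k + 1)) \<longlonglongrightarrow> u" using tendsto_diff[OF tendsto_const[of u] mesh] by simp
    show "\<forall>\<^sub>F k in sequentially. u - T / real (k + 1) \<le> ?r k"
    proof (rule always_eventually, rule)
      fix k show "u - T / real (k + 1) \<le> ?r k"
        using i(2)[of k] grid_Suc_diff[of T k "i k"] by linarith
    qed
    show "\<forall>\<^sub>F k in sequentially. ?r k \<le> u" using i(1) by (auto simp: less_imp_le)
  qed simp
  have "filterlim ?r (at_left u) sequentially"
    unfolding filterlim_at using r i(1) by (auto simp: less_imp_neq)
  moreover have "((\<lambda>t. H t \<omega>) \<longlongrightarrow> H u \<omega>) (at_left u)"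
    using H u unfolding caglad_on_def by auto
  ultimately have lim: "(\<lambda>k. H (?r k) \<omega>) \<longlonglongrightarrow> H u \<omega>" by (rule filterlim_compose[rotated])
  have "eventually (\<lambda>k. \<bar>H (?r k) \<omega>\<bar> < \<bar>H u \<omega>\<bar> + 1) sequentially"
    using tendsto_rabs[OF lim] by (rule order_tendstoD) simp
  moreover have "eventually (\<lambda>k. \<bar>H u \<omega>\<bar> + 1 \<le> real k) sequentially"
    by (rule eventually_sequentiallyI[of "nat \<lceil>\<bar>H u \<omega>\<bar> + 1\<rceil>"]) linarith
  moreover have "eventually (\<lambda>k. ?r k > 0) sequentially"
    using r by (rule order_tendstoD) (use u in auto)
  ultimately have "eventually (\<lambda>k. H (?r k) \<omega> = left_point T H k (i k) \<omega>) sequentially"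
  proof eventually_elim
    case (elim k)
    then have "i k \<noteq> 0" by (auto intro: ccontr)
    then show ?case unfolding left_point_def using elim by (auto simp: min_def max_def)
  qed
  then show ?thesis unfolding i(3) using lim by (rule Lim_transform_eventually[rotated])
qed

lemma sup_process_bounds:
  assumes H: "caglad_on T (\<lambda>t. H t \<omega>)" and u: "u \<in> {0<..T}"
  shows sup_process_bdd: "bdd_above ((\<lambda>q. \<bar>H q \<omega>\<bar>) ` {q\<in>\<rat>. 0 < q \<and> q < u})"
    and sup_process_nonempty: "{q\<in>\<rat>. 0 < q \<and> q < u} \<noteq> {}"
    and sup_process_upper: "s \<in> {0<..u} \<Longrightarrow> \<bar>H s \<omega>\<bar> \<le> sup_process H u \<omega>"
proof -
  obtain B where B: "\<And>s. s \<in> {0<..T} \<Longrightarrow> \<bar>H s \<omega>\<bar> \<le> B" using caglad_bounded[OF H] by blast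
  show bdd: "bdd_above ((\<lambda>q. \<bar>H q \<omega>\<bar>) ` {q\<in>\<rat>. 0 < q \<and> q < u})"
    by (rule bdd_aboveI2[of _ _ B]) (use B u in auto)
  show "{q\<in>\<rat>. 0 < q \<and> q < u} \<noteq> {}" using Rats_dense_in_real[of 0 u] u by auto
  assume s: "s \<in> {0<..u}"
  show "\<bar>H s \<omega>\<bar> \<le> sup_process H u \<omega>"
  proof (rule ccontr)
    assume "\<not> ?thesis"
    then have less: "sup_process H u \<omega> < \<bar>H s \<omega>\<bar>" by simp
    have "((\<lambda>t. \<bar>H t \<omega>\<bar>) \<longlongrightarrow> \<bar>H s \<omega>\<bar>) (at_left s)"
      using H u s unfolding caglad_on_def by (intro tendsto_rabs) auto
    then have "eventually (\<lambda>t. sup_process H u \<omega> < \<bar>H t \<omega>\<bar>) (at_left s)"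
      by (rule order_tendstoD) (rule less)
    then obtain b where b: "b < s" "\<forall>y>b. y < s \<longrightarrow> sup_process H u \<omega> < \<bar>H y \<omega>\<bar>"
      unfolding eventually_at_left_field by blast
    obtain q where q: "q \<in> \<rat>" "max b 0 < q" "q < s"
      using Rats_dense_in_real[of "max b 0" s] b(1) s by auto
    have "\<bar>H q \<omega>\<bar> \<le> sup_process H u \<omega>"
      unfolding sup_process_def by (rule cSUP_upper[OF _ bdd]) (use q s in auto)
    then show False using b(2) q by force
  qed
qed

text \<open>The supremum is monotone in \<open>u\<close>, which gives the right limits. It is left-continuous because the
  supremum over the open interval \<open>(0, u)\<close> is nearly attained at a time strictly before \<open>u\<close>.\<close>

lemma sup_process_caglad:
  assumes fps: "filtered_prob_space P F T" and H: "adapted_caglad P F T H"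
  shows "adapted_caglad P F T (sup_process H)"
proof -
  have T: "0 < T" and F: "subalgebra P (F t)" and mono: "s \<le> t \<Longrightarrow> sets (F s) \<subseteq> sets (F t)" for s t
    using fps unfolding filtered_prob_space_def filtration_def by auto
  have sp: "space (F t) = space P" for t using F[of t] by (simp add: subalgebra_def)
  have cag: "caglad_on T (\<lambda>t. H t \<omega>)" if "\<omega> \<in> space P" for \<omega>
    using H that unfolding adapted_caglad_def by auto
  have meas: "sup_process H u \<in> borel_measurable (F u)" if u: "u \<in> {0<..T}" for u
  proof -
    have ne: "{q\<in>\<rat>. 0 < q \<and> q < u} \<noteq> {}" using Rats_dense_in_real[of 0 u] u by auto
    have "(\<lambda>\<omega>. SUP q\<in>{q\<in>\<rat>. 0 < q \<and> q < u}. \<bar>H q \<omega>\<bar>) \<in> borel_measurable (F u)"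
    proof (rule borel_measurable_cSUP)
      show "countable {q\<in>\<rat>. 0 < q \<and> q < u}"
        by (rule countable_subset[OF _ countable_rat]) auto
      fix q assume q: "q \<in> {q\<in>\<rat>. 0 < q \<and> q < u}"
      then have "H q \<in> borel_measurable (F q)" using H u unfolding adapted_caglad_def by auto
      then have "H q \<in> borel_measurable (F u)"
        by (rule measurable_mono[OF order_refl refl, THEN subsetD, rotated 2])
          (use mono[of q u] q sp in auto)
      then show "(\<lambda>\<omega>. \<bar>H q \<omega>\<bar>) \<in> borel_measurable (F u)" by simp
    next
      fix \<omega> assume "\<omega> \<in> space (F u)"
      then show "bdd_above ((\<lambda>q. \<bar>H q \<omega>\<bar>) ` {q\<in>\<rat>. 0 < q \<and> q < u})"
        using sup_process_bdd[where H=H and T=T, OF cag u] sp by auto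
    qed
    then show ?thesis unfolding sup_process_def[abs_def] .
  qed
  have "caglad_on T (\<lambda>u. sup_process H u \<omega>)" if w: "\<omega> \<in> space P" for \<omega>
  proof -
    note c = cag[OF w]
    have mono: "sup_process H s \<omega> \<le> sup_process H u \<omega>" if "0 < s" "s \<le> u" "u \<le> T" for s u
      unfolding sup_process_def
      by (rule cSUP_subset_mono[OF sup_process_nonempty[where T=T and H=H and \<omega>=\<omega>] sup_process_bdd[where T=T]]) (use that c in auto)
    have "((\<lambda>u. sup_process H u \<omega>) \<longlongrightarrow> sup_process H t \<omega>) (at_left t)" if t: "t \<in> {0<..T}" for t
    proof (rule order_tendstoI)
      fix a assume "a < sup_process H t \<omega>"
      then obtain q where q: "q \<in> \<rat>" "0 < q" "q < t" "a < \<bar>H q \<omega>\<bar>"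
        unfolding sup_process_def using less_cSUP_iff[OF sup_process_nonempty[where H=H and T=T, OF c t] sup_process_bdd[where H=H and T=T, OF c t]] by auto
      have "a < sup_process H s \<omega>" if "q < s" "s < t" for s
        using sup_process_upper[where H=H and T=T, OF c, of s q] q that t by auto
      then show "eventually (\<lambda>s. a < sup_process H s \<omega>) (at_left t)"
        unfolding eventually_at_left_field using q by blast
    next
      fix a assume a: "sup_process H t \<omega> < a"
      have "sup_process H s \<omega> < a" if "0 < s" "s < t" for s
        using mono[of s t] that t a by auto
      then show "eventually (\<lambda>s. sup_process H s \<omega> < a) (at_left t)"
        unfolding eventually_at_left_field using t by (intro exI[of _ 0]) auto
    qed
    moreover have "\<exists>l. ((\<lambda>u. sup_process H u \<omega>) \<longlongrightarrow> l) (at_right t)" if t: "t \<in> {0..<T}" for t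
    proof -
      let ?S = "(\<lambda>u. sup_process H u \<omega>) ` {t<..T}"
      have ne: "?S \<noteq> {}" using t by auto
      have pos: "0 \<le> sup_process H u \<omega>" if "u \<in> {0<..T}" for u
        using sup_process_upper[where H=H and T=T, OF c that, of u] that by auto
      have bdd: "bdd_below ?S" by (rule bdd_belowI2[of _ 0]) (use pos t in auto)
      have "((\<lambda>u. sup_process H u \<omega>) \<longlongrightarrow> Inf ?S) (at_right t)"
      proof (rule order_tendstoI)
        fix a assume a: "a < Inf ?S"
        have "a < sup_process H s \<omega>" if "t < s" "s < T" for s
          using cInf_lower[OF _ bdd, of "sup_process H s \<omega>"] that a by fastforce
        then show "eventually (\<lambda>s. a < sup_process H s \<omega>) (at_right t)"
          unfolding eventually_at_right_field using t by (intro exI[of _ T]) auto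
      next
        fix a assume "Inf ?S < a"
        then obtain q where q: "t < q" "q \<le> T" "sup_process H q \<omega> < a"
          using cInf_lessD[OF ne] by fastforce
        have "sup_process H s \<omega> < a" if "t < s" "s < q" for s
          using mono[of s q] q that t by auto
        then show "eventually (\<lambda>s. sup_process H s \<omega> < a) (at_right t)"
          unfolding eventually_at_right_field using q by blast
      qed
      then show ?thesis by blast
    qed
    ultimately show ?thesis unfolding caglad_on_def by blast
  qed
  with meas show ?thesis unfolding adapted_caglad_def by blast
qed

lemma ito_integral_left_point_ucp:
  assumes fps: "filtered_prob_space P F T" and ito: "ito_integral P F T H X U"
  shows "ucp_tendsto P T (\<lambda>k. elementary_integral (Suc k) (grid T k) (left_point T H k) X) U"
proof -
  have T: "0 < T" using fps unfolding filtered_prob_space_def by auto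
  have H: "adapted_caglad P F T H" using ito unfolding ito_integral_def by auto
  then have c: "caglad_on T (\<lambda>t. H t \<omega>)" if "\<omega> \<in> space P" for \<omega>
    using that unfolding adapted_caglad_def by auto
  have dom: "\<bar>elementary_process (Suc k) (grid T k) (left_point T H k) u \<omega>\<bar> \<le> sup_process H u \<omega>"
    if u: "u \<in> {0<..T}" and w: "\<omega> \<in> space P" for k u \<omega>
  proof -
    obtain i where i: "i \<le> k" "grid T k i < u"
      "elementary_process (Suc k) (grid T k) (left_point T H k) u \<omega> = left_point T H k i \<omega>"
      using elementary_process_at[OF T u] by metis
    show ?thesis
    proof (cases "i = 0")
      case True
      then show ?thesis using i sup_process_upper[where H=H and T=T, OF c[OF w] u, of u] u by (auto simp: left_point_def)
    next
      case False
      then have "0 < grid T k i" using T by (simp add: grid_def)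
      then show ?thesis
        using i False sup_process_upper[where H=H and T=T, OF c[OF w] u, of "grid T k i"] abs_left_point_le[of T H k i \<omega>] by auto
    qed
  qed
  show ?thesis
    using ito elementary_left_point[OF fps H] sup_process_caglad[OF fps H] dom left_point_tendsto[where H=H, OF T c]
    unfolding ito_integral_def by blast
qed

text \<open>If \<open>J k\<close> converges path by path to \<open>L\<close> and \<open>\<bar>L t - U t\<bar>\<close> exceeds \<open>\<epsilon>\<close> at some time, then the path lies
  in the exceptional sets of all large \<open>k\<close>; the limit inferior of sets whose probabilities tend to
  \<open>0\<close> is a null set. These sets quantify over all times, so the equality holds for all times at once.\<close>

lemma ucp_limit_unique:
  assumes fps: "filtered_prob_space P F T"
    and J: "\<And>k. \<And>t. t \<in> {0..T} \<Longrightarrow> J k t \<in> borel_measurable P"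
    and U: "\<And>t. t \<in> {0..T} \<Longrightarrow> U t \<in> borel_measurable P"
    and Jr: "\<And>k \<omega>. \<omega> \<in> space P \<Longrightarrow> cadlag_on T (\<lambda>t. J k t \<omega>)"
    and Ur: "\<And>\<omega>. \<omega> \<in> space P \<Longrightarrow> cadlag_on T (\<lambda>t. U t \<omega>)"
    and ucp: "ucp_tendsto P T J U"
    and lim: "AE \<omega> in P. \<forall>t\<in>{0..T}. (\<lambda>k. J k t \<omega>) \<longlonglongrightarrow> L t \<omega>"
  shows "AE \<omega> in P. \<forall>t\<in>{0..T}. U t \<omega> = L t \<omega>"
proof -
  interpret prob_space P using fps unfolding filtered_prob_space_def by auto
  have T: "0 < T" using fps unfolding filtered_prob_space_def by auto
  define B where "B \<epsilon> k = {\<omega>\<in>space P. \<exists>t\<in>{0..T}. \<bar>J k t \<omega> - U t \<omega>\<bar> > \<epsilon>}" for \<epsilon> k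
  \<comment> \<open>By right-continuity the exceedance already happens at a rational time or at \<open>T\<close>.\<close>
  have Bm: "B \<epsilon> k \<in> sets P" for \<epsilon> k
  proof -
    let ?Q = "insert T (\<rat> \<inter> {0..T})"
    have "B \<epsilon> k = (\<Union>q\<in>?Q. {\<omega>\<in>space P. \<bar>J k q \<omega> - U q \<omega>\<bar> > \<epsilon>})"
    proof (intro set_eqI iffI)
      fix \<omega> assume "\<omega> \<in> B \<epsilon> k"
      then obtain t where w: "\<omega> \<in> space P" and t: "t \<in> {0..T}" "\<bar>J k t \<omega> - U t \<omega>\<bar> > \<epsilon>"
        unfolding B_def by auto
      show "\<omega> \<in> (\<Union>q\<in>?Q. {\<omega>\<in>space P. \<bar>J k q \<omega> - U q \<omega>\<bar> > \<epsilon>})"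
      proof (cases "t = T")
        case False
        then have "((\<lambda>t. \<bar>J k t \<omega> - U t \<omega>\<bar>) \<longlongrightarrow> \<bar>J k t \<omega> - U t \<omega>\<bar>) (at_right t)"
          using Jr[OF w, of k] Ur[OF w] t unfolding cadlag_on_def by (intro tendsto_intros) auto
        then have "eventually (\<lambda>s. \<epsilon> < \<bar>J k s \<omega> - U s \<omega>\<bar>) (at_right t)"
          by (rule order_tendstoD) (use t in auto)
        then obtain b where b: "t < b" "\<forall>y>t. y < b \<longrightarrow> \<epsilon> < \<bar>J k y \<omega> - U y \<omega>\<bar>"
          unfolding eventually_at_right_field by blast
        obtain q where "q \<in> \<rat>" "t < q" "q < min b T"
          using Rats_dense_in_real[of t "min b T"] b(1) t False by auto
        then show ?thesis using b(2) t w by force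
      qed (use w t in auto)
    qed (use T in \<open>auto simp: B_def\<close>)
    moreover have "countable ?Q" using countable_subset[OF _ countable_rat, of "\<rat> \<inter> {0..T}"] by simp
    moreover have "{\<omega>\<in>space P. \<bar>J k q \<omega> - U q \<omega>\<bar> > \<epsilon>} \<in> sets P" if "q \<in> ?Q" for q
    proof -
      have [measurable]: "J k q \<in> borel_measurable P" "U q \<in> borel_measurable P"
        using J U that T by auto
      show ?thesis by measurable
    qed
    ultimately show ?thesis using sets.countable_UN''[of ?Q "\<lambda>q. {\<omega>\<in>space P. \<bar>J k q \<omega> - U q \<omega>\<bar> > \<epsilon>}" P]
      by presburger
  qed
  have null: "(\<Inter>k\<in>{n..}. B \<epsilon> k) \<in> null_sets P" if "0 < \<epsilon>" for \<epsilon> n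
  proof -
    have "(\<lambda>k. measure P (B \<epsilon> k)) \<longlonglongrightarrow> 0"
      using ucp that unfolding ucp_tendsto_def B_def by blast
    moreover have "measure P (\<Inter>k\<in>{n..}. B \<epsilon> k) \<le> measure P (B \<epsilon> k)" if "k \<ge> n" for k
      by (rule finite_measure_mono) (use Bm that in auto)
    ultimately have "measure P (\<Inter>k\<in>{n..}. B \<epsilon> k) \<le> 0"
      by (intro LIMSEQ_le_const[where a="measure P (\<Inter>k\<in>{n..}. B \<epsilon> k)"]) auto
    moreover have "(\<Inter>k\<in>{n..}. B \<epsilon> k) \<in> sets P"
      using Bm by (intro sets.countable_INT') auto
    ultimately show ?thesis by (auto simp: null_sets_def emeasure_eq_measure measure_le_0_iff)
  qed
  have "AE \<omega> in P. \<forall>n m. \<omega> \<notin> (\<Inter>k\<in>{n..}. B (1 / real (Suc m)) k)"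
    unfolding AE_all_countable by (intro allI AE_not_in null) simp
  with lim AE_space show ?thesis
  proof eventually_elim
    case (elim \<omega>)
    show ?case
    proof
      fix t assume t: "t \<in> {0..T}"
      have "\<bar>L t \<omega> - U t \<omega>\<bar> \<le> 1 / real (Suc m)" for m
      proof (rule ccontr)
        assume "\<not> ?thesis"
        then have "1 / real (Suc m) < \<bar>L t \<omega> - U t \<omega>\<bar>" by simp
        moreover have "(\<lambda>k. \<bar>J k t \<omega> - U t \<omega>\<bar>) \<longlonglongrightarrow> \<bar>L t \<omega> - U t \<omega>\<bar>"
          using elim t by (intro tendsto_intros) auto
        ultimately have "eventually (\<lambda>k. 1 / real (Suc m) < \<bar>J k t \<omega> - U t \<omega>\<bar>) sequentially"
          by (intro order_tendstoD)
        then obtain n where "\<forall>k\<ge>n. 1 / real (Suc m) < \<bar>J k t \<omega> - U t \<omega>\<bar>"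
          unfolding eventually_sequentially by blast
        then have "\<omega> \<in> (\<Inter>k\<in>{n..}. B (1 / real (Suc m)) k)"
          using elim t unfolding B_def by blast
        then show False using elim by blast
      qed
      then have "\<bar>L t \<omega> - U t \<omega>\<bar> \<le> 0"
        by (intro LIMSEQ_le_const[OF LIMSEQ_Suc[OF lim_1_over_n]]) auto
      then show "U t \<omega> = L t \<omega>" by simp
    qed
  qed
qed

lemma cadlag_on_add:
  assumes "cadlag_on T f" "cadlag_on T g"
  shows "cadlag_on T (\<lambda>t. f t + g t)"
  unfolding cadlag_on_def
proof (intro conjI ballI)
  fix t assume "t \<in> {0<..T}"
  then obtain l m where "(f \<longlongrightarrow> l) (at_left t)" "(g \<longlongrightarrow> m) (at_left t)"
    using assms unfolding cadlag_on_def by blast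
  then show "\<exists>l. ((\<lambda>t. f t + g t) \<longlongrightarrow> l) (at_left t)" using tendsto_add by blast
qed (use assms in \<open>auto simp: cadlag_on_def intro: tendsto_add\<close>)

lemma cadlag_on_cmult:
  assumes "cadlag_on T f"
  shows "cadlag_on T (\<lambda>t. c * f t)"
  unfolding cadlag_on_def
proof (intro conjI ballI)
  fix t assume "t \<in> {0<..T}"
  then obtain l where "(f \<longlongrightarrow> l) (at_left t)"
    using assms unfolding cadlag_on_def by blast
  then show "\<exists>l. ((\<lambda>t. c * f t) \<longlongrightarrow> l) (at_left t)" using tendsto_mult_left by blast
qed (use assms in \<open>auto simp: cadlag_on_def intro: tendsto_mult_left\<close>)

lemma cadlag_on_const: "cadlag_on T (\<lambda>t. c)"
  unfolding cadlag_on_def by auto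

lemma cadlag_on_stopped:
  assumes f: "cadlag_on T f" and "0 \<le> r"
  shows "cadlag_on T (\<lambda>t. f (min r t))"
  unfolding cadlag_on_def
proof (intro conjI ballI)
  fix t assume t: "t \<in> {0..<T}"
  show "((\<lambda>t. f (min r t)) \<longlongrightarrow> f (min r t)) (at_right t)"
  proof (cases "t < r")
    case True
    have "eventually (\<lambda>s. f s = f (min r s)) (at_right t)"
      unfolding eventually_at_right_field using True by (intro exI[of _ r]) auto
    moreover have "(f \<longlongrightarrow> f (min r t)) (at_right t)"
      using f t True unfolding cadlag_on_def by auto
    ultimately show ?thesis by (rule Lim_transform_eventually[rotated])
  next
    case False
    have "eventually (\<lambda>s. f (min r t) = f (min r s)) (at_right t)"
      unfolding eventually_at_right_field using False by (intro exI[of _ "t + 1"]) auto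
    with tendsto_const show ?thesis by (rule Lim_transform_eventually)
  qed
next
  fix t assume t: "t \<in> {0<..T}"
  show "\<exists>l. ((\<lambda>t. f (min r t)) \<longlongrightarrow> l) (at_left t)"
  proof (cases "t \<le> r")
    case True
    obtain l where l: "(f \<longlongrightarrow> l) (at_left t)" using f t unfolding cadlag_on_def by blast
    have "eventually (\<lambda>s. f s = f (min r s)) (at_left t)"
      unfolding eventually_at_left_field using True by (intro exI[of _ "t - 1"]) auto
    with l show ?thesis by (intro exI) (rule Lim_transform_eventually)
  next
    case False
    have "eventually (\<lambda>s. f r = f (min r s)) (at_left t)"
      unfolding eventually_at_left_field using False by (intro exI[of _ r]) auto
    with tendsto_const show ?thesis by (intro exI) (rule Lim_transform_eventually)
  qed
qed

lemma cadlag_on_sum: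
  "(\<And>i. i \<in> A \<Longrightarrow> cadlag_on T (f i)) \<Longrightarrow> cadlag_on T (\<lambda>t. \<Sum>i\<in>A. f i t)"
  by (induction A rule: infinite_finite_induct) (auto intro: cadlag_on_const cadlag_on_add)

lemma elementary_integral_cadlag:
  assumes X: "cadlag_on T (\<lambda>t. X t \<omega>)" and r: "\<And>i. i \<le> n \<Longrightarrow> 0 \<le> r i"
  shows "cadlag_on T (\<lambda>t. elementary_integral n r \<xi> X t \<omega>)"
proof -
  have "cadlag_on T (\<lambda>t. \<Sum>i<n. \<xi> i \<omega> * (X (min (r (Suc i)) t) \<omega> + (-1) * X (min (r i) t) \<omega>))"
    using r by (intro cadlag_on_sum cadlag_on_cmult cadlag_on_add cadlag_on_stopped[OF X]) auto
  then show ?thesis unfolding elementary_integral_def by simp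
qed

text \<open>The way in which all integrals below are evaluated: find the pathwise limit of the left-point sums.\<close>

lemma ito_integral_eqI:
  assumes fps: "filtered_prob_space P F T" and ito: "ito_integral P F T H X U"
    and lim: "AE \<omega> in P. \<forall>t\<in>{0..T}.
      (\<lambda>k. elementary_integral (Suc k) (grid T k) (left_point T H k) X t \<omega>) \<longlonglongrightarrow> L t \<omega>"
  shows "AE \<omega> in P. \<forall>t\<in>{0..T}. U t \<omega> = L t \<omega>"
proof (rule ucp_limit_unique[OF fps _ _ _ _ ito_integral_left_point_ucp[OF fps ito] lim])
  have T: "0 < T" and F: "subalgebra P (F t)" for t using fps unfolding filtered_prob_space_def by auto
  have X: "adapted_cadlag P F T X" and U: "adapted_cadlag P F T U" and H: "adapted_caglad P F T H"
    using ito unfolding ito_integral_def semimartingale_def by auto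
  have Xm: "X t \<in> borel_measurable P" if "t \<in> {0..T}" for t
    using X that measurable_from_subalg[OF F] unfolding adapted_cadlag_def adapted_def by blast
  show "U t \<in> borel_measurable P" if "t \<in> {0..T}" for t
    using U that measurable_from_subalg[OF F] unfolding adapted_cadlag_def adapted_def by blast
  show "cadlag_on T (\<lambda>t. U t \<omega>)" if "\<omega> \<in> space P" for \<omega>
    using U that unfolding adapted_cadlag_def by blast
  show "cadlag_on T (\<lambda>t. elementary_integral (Suc k) (grid T k) (left_point T H k) X t \<omega>)"
    if "\<omega> \<in> space P" for \<omega> k
    using X that T grid_bounds[OF T, of _ k] unfolding adapted_cadlag_def
    by (intro elementary_integral_cadlag) auto
  show "elementary_integral (Suc k) (grid T k) (left_point T H k) X t \<in> borel_measurable P"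
    if t: "t \<in> {0..T}" for k t
  proof -
    have "left_point T H k i \<in> borel_measurable P" if "i < Suc k" for i
      using elementary_left_point[OF fps H, of k] that measurable_from_subalg[OF F]
      unfolding elementary_def by blast
    moreover have "X (min (grid T k i) t) \<in> borel_measurable P" if "i \<le> Suc k" for i
      using grid_bounds[OF T that] t by (intro Xm) auto
    ultimately show ?thesis unfolding elementary_integral_def[abs_def]
      by (intro borel_measurable_sum borel_measurable_times borel_measurable_diff) auto
  qed
qed

section \<open>Pure-jump paths\<close>

text \<open>Path properties are stated for a process at a fixed outcome, since they hold for almost all
  outcomes only. A path with \<open>pure_jump\<close> starts at \<open>0\<close>.\<close>

definition jump_times :: "real \<Rightarrow> 'a process \<Rightarrow> 'a \<Rightarrow> real set" where
  "jump_times T X \<omega> = {u\<in>{0<..T}. jump X u \<omega> \<noteq> 0}"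

definition pure_jump :: "real \<Rightarrow> 'a process \<Rightarrow> 'a \<Rightarrow> bool" where
  "pure_jump T X \<omega> \<longleftrightarrow> finite (jump_times T X \<omega>) \<and>
     (\<forall>t\<in>{0..T}. X t \<omega> = (\<Sum>v\<in>jump_times T X \<omega> \<inter> {..t}. jump X v \<omega>))"

lemma jump_times_subset: "jump_times T X \<omega> \<subseteq> {0<..T}"
  unfolding jump_times_def by auto

text \<open>Moves sums over the jumps of different paths to a common finite set of times.\<close>

lemma sum_jump_times:
  assumes "finite D" "D \<subseteq> {0<..T}" "jump_times T X \<omega> \<subseteq> D" "\<And>v. jump X v \<omega> = 0 \<Longrightarrow> g v = 0"
  shows "(\<Sum>v\<in>jump_times T X \<omega> \<inter> A. g v) = (\<Sum>v\<in>D \<inter> A. g v)"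
  by (rule sum.mono_neutral_left) (use assms in \<open>auto simp: jump_times_def\<close>)

lemma step_path_left_limit:
  assumes D: "finite D" and X: "\<And>t. t \<in> {0..T} \<Longrightarrow> X t \<omega> = (\<Sum>v\<in>D \<inter> {..t}. c v)"
    and u: "u \<in> {0<..T}"
  shows "left_limit X u \<omega> = (\<Sum>v\<in>D \<inter> {..<u}. c v)"
proof (rule left_limitI)
  have "eventually (\<lambda>s. \<forall>v\<in>D \<inter> {..<u}. v < s) (at_left u)"
    using D by (intro eventually_ball_finite ballI) (auto simp: eventually_at_left_field)
  moreover have "eventually (\<lambda>s. 0 < s \<and> s < u) (at_left u)"
    unfolding eventually_at_left_field using u by (intro exI[of _ 0]) auto
  ultimately have "eventually (\<lambda>s. (\<Sum>v\<in>D \<inter> {..<u}. c v) = X s \<omega>) (at_left u)"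
  proof eventually_elim
    case (elim s)
    then have "D \<inter> {..s} = D \<inter> {..<u}" by (auto simp: less_imp_le)
    then show ?case using X[of s] elim u by simp
  qed
  with tendsto_const show "((\<lambda>s. X s \<omega>) \<longlongrightarrow> (\<Sum>v\<in>D \<inter> {..<u}. c v)) (at_left u)"
    by (rule Lim_transform_eventually)
qed

lemma step_path_jump:
  assumes D: "finite D" and X: "\<And>t. t \<in> {0..T} \<Longrightarrow> X t \<omega> = (\<Sum>v\<in>D \<inter> {..t}. c v)"
    and u: "u \<in> {0<..T}"
  shows "jump X u \<omega> = (if u \<in> D then c u else 0)"
proof -
  have "D \<inter> {..u} = (D \<inter> {..<u}) \<union> (D \<inter> {u})" by auto
  then have "(\<Sum>v\<in>D \<inter> {..u}. c v) = (\<Sum>v\<in>D \<inter> {..<u}. c v) + (\<Sum>v\<in>D \<inter> {u}. c v)"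
    using D by (simp add: sum.union_disjoint[symmetric] disjoint_iff)
  moreover have "left_limit X u \<omega> = (\<Sum>v\<in>D \<inter> {..<u}. c v)"
    by (rule step_path_left_limit[of D T X \<omega> c, OF D X u])
  ultimately show ?thesis
    using X[of u] u by (auto simp: jump_def)
qed

lemma step_path_pure_jump:
  assumes D: "finite D" "D \<subseteq> {0<..T}" and X: "\<And>t. t \<in> {0..T} \<Longrightarrow> X t \<omega> = (\<Sum>v\<in>D \<inter> {..t}. c v)"
  shows "pure_jump T X \<omega>"
proof -
  note j = step_path_jump[of D T X \<omega> c, OF D(1) X]
  have sub: "jump_times T X \<omega> \<subseteq> D" unfolding jump_times_def using j by (auto split: if_splits)
  have "X t \<omega> = (\<Sum>v\<in>jump_times T X \<omega> \<inter> {..t}. jump X v \<omega>)" if "t \<in> {0..T}" for t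
  proof -
    have "(\<Sum>v\<in>jump_times T X \<omega> \<inter> {..t}. jump X v \<omega>) = (\<Sum>v\<in>D \<inter> {..t}. jump X v \<omega>)"
      by (rule sum_jump_times[OF D sub])
    also have "\<dots> = (\<Sum>v\<in>D \<inter> {..t}. c v)" using j D by (intro sum.cong) auto
    finally show ?thesis using X[OF that] by simp
  qed
  then show ?thesis unfolding pure_jump_def using finite_subset[OF sub D(1)] by blast
qed

lemma pure_jump_left_limit:
  assumes "pure_jump T X \<omega>" "u \<in> {0<..T}"
  shows "left_limit X u \<omega> = (\<Sum>v\<in>jump_times T X \<omega> \<inter> {..<u}. jump X v \<omega>)"
  using step_path_left_limit[of "jump_times T X \<omega>" T X \<omega> "\<lambda>v. jump X v \<omega>"] assms unfolding pure_jump_def by blast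

text \<open>Each jump \<open>c v\<close> of the integrator is multiplied by the value of the elementary integrand at \<open>v\<close>,
  since exactly the cell \<open>(r\<^sub>i, r\<^sub>i\<^sub>+\<^sub>1]\<close> containing \<open>v\<close> sees it.\<close>

lemma elementary_integral_step_path:
  assumes D: "finite D" and X: "\<And>t. t \<in> {0..T} \<Longrightarrow> X t \<omega> = (\<Sum>v\<in>D \<inter> {..t}. c v)"
    and r: "\<And>i. i \<le> n \<Longrightarrow> r i \<in> {0..T}" and mono: "\<And>i. i < n \<Longrightarrow> r i \<le> r (Suc i)" and t: "t \<in> {0..T}"
  shows "elementary_integral n r \<xi> X t \<omega> = (\<Sum>v\<in>D \<inter> {..t}. elementary_process n r \<xi> v \<omega> * c v)"
proof -
  have "X (min (r (Suc i)) t) \<omega> - X (min (r i) t) \<omega> = (\<Sum>v\<in>D \<inter> {..t}. indicator {r i<..r (Suc i)} v * c v)"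
    if i: "i < n" for i
  proof -
    have "X (min s t) \<omega> = (\<Sum>v\<in>D \<inter> {..t}. indicator {..s} v * c v)" if "s \<in> {0..T}" for s
    proof -
      have "X (min s t) \<omega> = (\<Sum>v\<in>D \<inter> {..min s t}. c v)" using that t by (intro X) auto
      also have "\<dots> = (\<Sum>v\<in>D \<inter> {..min s t}. indicator {..s} v * c v)" by (intro sum.cong) auto
      also have "\<dots> = (\<Sum>v\<in>D \<inter> {..t}. indicator {..s} v * c v)"
        using D by (intro sum.mono_neutral_left) (auto simp: indicator_def)
      finally show ?thesis .
    qed
    then have "X (min (r (Suc i)) t) \<omega> - X (min (r i) t) \<omega>
      = (\<Sum>v\<in>D \<inter> {..t}. indicator {..r (Suc i)} v * c v - indicator {..r i} v * c v)"
      using r[of i] r[of "Suc i"] i by (simp add: sum_subtractf)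
    also have "\<dots> = (\<Sum>v\<in>D \<inter> {..t}. indicator {r i<..r (Suc i)} v * c v)"
      using mono[OF i] by (intro sum.cong) (auto simp: indicator_def)
    finally show ?thesis .
  qed
  then have "elementary_integral n r \<xi> X t \<omega>
    = (\<Sum>i<n. \<Sum>v\<in>D \<inter> {..t}. \<xi> i \<omega> * indicator {r i<..r (Suc i)} v * c v)"
    unfolding elementary_integral_def by (simp add: sum_distrib_left mult.assoc)
  also have "\<dots> = (\<Sum>v\<in>D \<inter> {..t}. \<Sum>i<n. \<xi> i \<omega> * indicator {r i<..r (Suc i)} v * c v)"
    by (rule sum.swap)
  finally show ?thesis unfolding elementary_process_def sum_distrib_right .
qed

lemma ito_integral_pure_jump_integrator:
  assumes fps: "filtered_prob_space P F T" and ito: "ito_integral P F T H X U"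
    and X: "AE \<omega> in P. pure_jump T X \<omega>"
  shows "AE \<omega> in P. \<forall>t\<in>{0..T}. U t \<omega> = (\<Sum>v\<in>jump_times T X \<omega> \<inter> {..t}. H v \<omega> * jump X v \<omega>)"
proof (rule ito_integral_eqI[OF fps ito])
  have T: "0 < T" using fps unfolding filtered_prob_space_def by auto
  have H: "caglad_on T (\<lambda>t. H t \<omega>)" if "\<omega> \<in> space P" for \<omega>
    using ito that unfolding ito_integral_def adapted_caglad_def by auto
  show "AE \<omega> in P. \<forall>t\<in>{0..T}. (\<lambda>k. elementary_integral (Suc k) (grid T k) (left_point T H k) X t \<omega>)
    \<longlonglongrightarrow> (\<Sum>v\<in>jump_times T X \<omega> \<inter> {..t}. H v \<omega> * jump X v \<omega>)"
    using X AE_space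
  proof eventually_elim
    case (elim \<omega>)
    show ?case
    proof
      fix t assume t: "t \<in> {0..T}"
      have "elementary_integral (Suc k) (grid T k) (left_point T H k) X t \<omega> = (\<Sum>v\<in>jump_times T X \<omega> \<inter> {..t}.
          elementary_process (Suc k) (grid T k) (left_point T H k) v \<omega> * jump X v \<omega>)" for k
        using elim(1) grid_bounds[OF T] grid_mono[OF T] t unfolding pure_jump_def
        by (intro elementary_integral_step_path) auto
      moreover have "(\<lambda>k. \<Sum>v\<in>jump_times T X \<omega> \<inter> {..t}.
          elementary_process (Suc k) (grid T k) (left_point T H k) v \<omega> * jump X v \<omega>)
          \<longlonglongrightarrow> (\<Sum>v\<in>jump_times T X \<omega> \<inter> {..t}. H v \<omega> * jump X v \<omega>)"
        using left_point_tendsto[where H=H, OF T H[OF elim(2)]] jump_times_subset[of T X \<omega>]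
        by (intro tendsto_sum tendsto_mult tendsto_const) auto
      ultimately show "(\<lambda>k. elementary_integral (Suc k) (grid T k) (left_point T H k) X t \<omega>)
        \<longlonglongrightarrow> (\<Sum>v\<in>jump_times T X \<omega> \<inter> {..t}. H v \<omega> * jump X v \<omega>)"
        by simp
    qed
  qed
qed

lemma sum_increments_from:
  fixes f :: "nat \<Rightarrow> real"
  shows "(\<Sum>i<n. of_bool (j \<le> i) * (f (Suc i) - f i)) = f n - f (min j n)"
  by (induction n) (auto simp: min_def le_Suc_eq)

text \<open>Once the clipping is inactive, the integrand at a left end point is the sum of the jumps of \<open>Y\<close>
  strictly before it. So the jump at \<open>v\<close> is multiplied by all increments of \<open>X\<close> from the first grid
  point after \<open>v\<close> on; they telescope, and right-continuity of \<open>X\<close> gives the limit \<open>X\<^sub>t - X\<^sub>v\<close>.\<close>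

lemma ito_integral_pure_jump_integrand:
  assumes fps: "filtered_prob_space P F T" and ito: "ito_integral P F T (left_limit Y) X U"
    and Y: "AE \<omega> in P. pure_jump T Y \<omega>"
  shows "AE \<omega> in P. \<forall>t\<in>{0..T}. U t \<omega> = (\<Sum>v\<in>jump_times T Y \<omega> \<inter> {..t}. jump Y v \<omega> * (X t \<omega> - X v \<omega>))"
proof (rule ito_integral_eqI[OF fps ito])
  let ?H = "left_limit Y"
  have T: "0 < T" using fps unfolding filtered_prob_space_def by auto
  have X: "cadlag_on T (\<lambda>t. X t \<omega>)" if "\<omega> \<in> space P" for \<omega>
    using ito that unfolding ito_integral_def semimartingale_def adapted_cadlag_def by auto
  show "AE \<omega> in P. \<forall>t\<in>{0..T}. (\<lambda>k. elementary_integral (Suc k) (grid T k) (left_point T ?H k) X t \<omega>)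
    \<longlonglongrightarrow> (\<Sum>v\<in>jump_times T Y \<omega> \<inter> {..t}. jump Y v \<omega> * (X t \<omega> - X v \<omega>))"
    using Y AE_space
  proof eventually_elim
    case (elim \<omega>)
    let ?D = "jump_times T Y \<omega>"
    have D: "finite ?D" "?D \<subseteq> {0<..T}" using elim jump_times_subset[of T Y \<omega>] unfolding pure_jump_def by auto
    \<comment> \<open>\<open>r v k\<close> is the first grid point after \<open>v\<close>; for \<open>v = T\<close> there is none, and the minimum puts it at \<open>T\<close>.\<close>
    define j where "j v k = Suc (nat \<lfloor>v * real (k + 1) / T\<rfloor>)" for v k
    define r where "r v k = grid T k (min (j v k) (Suc k))" for v k
    show ?case
    proof
      fix t assume t: "t \<in> {0..T}"
      have r_le: "r v k \<le> T" for v k using grid_bounds[OF T, of "min (j v k) (Suc k)" k] unfolding r_def by auto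
      have r_ge: "v \<le> r v k" if "v \<in> ?D" for v k
        using less_grid_iff[OF T, of v k "j v k"] D(2) that unfolding r_def j_def min_def
        by (auto simp: subset_iff)
      have r_close: "r v k \<le> v + T / real (k + 1)" if v: "v \<in> ?D" for v k
      proof -
        have "\<not> v < grid T k (j v k - 1)"
          using less_grid_iff[OF T, of v k "j v k - 1"] D(2) v unfolding j_def by (auto simp: subset_iff)
        then have "grid T k (j v k) \<le> v + T / real (k + 1)"
          using grid_Suc_diff[of T k "j v k - 1"] unfolding j_def by simp
        moreover have "r v k \<le> grid T k (j v k)"
          unfolding r_def by (rule grid_mono[OF T]) simp
        ultimately show ?thesis by linarith
      qed
      have lim: "(\<lambda>k. X (min (r v k) t) \<omega>) \<longlonglongrightarrow> X (min v t) \<omega>" if v: "v \<in> ?D" for v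
      proof -
        have mesh: "(\<lambda>k. T / real (k + 1)) \<longlonglongrightarrow> 0"
          using LIMSEQ_Suc[OF lim_const_over_n[of T]] by simp
        have "(\<lambda>k. r v k) \<longlonglongrightarrow> v"
        proof (rule tendsto_sandwich[of "\<lambda>k. v" _ _ "\<lambda>k. v + T / real (k + 1)"])
          show "(\<lambda>k. v + T / real (k + 1)) \<longlonglongrightarrow> v" using tendsto_add[OF tendsto_const[of v] mesh] by simp
        qed (use r_ge[OF v] r_close[OF v] in auto)
        then have "(\<lambda>k. min (r v k) t) \<longlonglongrightarrow> min v t" by (intro tendsto_min tendsto_const)
        then show ?thesis
          using r_ge[OF v] r_le[of v] D(2) v t
          by (intro cadlag_tendsto_from_right[OF X[OF elim(2)]]) (auto intro!: min.mono simp: min_le_iff_disj)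
      qed
      have "eventually (\<lambda>k. (\<Sum>v\<in>?D. \<bar>jump Y v \<omega>\<bar>) \<le> real k) sequentially"
        by (rule eventually_sequentiallyI[of "nat \<lceil>\<Sum>v\<in>?D. \<bar>jump Y v \<omega>\<bar>\<rceil>"]) linarith
      then have "eventually (\<lambda>k. (\<Sum>v\<in>?D. jump Y v \<omega> * (X t \<omega> - X (min (r v k) t) \<omega>))
         = elementary_integral (Suc k) (grid T k) (left_point T ?H k) X t \<omega>) sequentially"
      proof eventually_elim
        case (elim k)
        have lp: "left_point T ?H k i \<omega> = (\<Sum>v\<in>?D. jump Y v \<omega> * of_bool (j v k \<le> i))" if i: "i < Suc k" for i
        proof (cases "i = 0")
          case True then show ?thesis by (simp add: left_point_def j_def)
        next
          case False
          then have "0 < grid T k i" using T by (simp add: grid_def)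
          then have g: "grid T k i \<in> {0<..T}" using grid_bounds[OF T, of i k] i by auto
          have "?H (grid T k i) \<omega> = (\<Sum>v\<in>?D \<inter> {..<grid T k i}. jump Y v \<omega>)"
            by (rule pure_jump_left_limit[OF \<open>pure_jump T Y \<omega>\<close> g])
          also have "\<dots> = (\<Sum>v\<in>?D. jump Y v \<omega> * of_bool (v < grid T k i))"
            using D(1) by (auto simp: sum.inter_restrict intro!: sum.cong)
          finally have H: "?H (grid T k i) \<omega> = (\<Sum>v\<in>?D. jump Y v \<omega> * of_bool (v < grid T k i))" .
          also have "\<bar>\<dots>\<bar> \<le> (\<Sum>v\<in>?D. \<bar>jump Y v \<omega>\<bar>)"
            by (rule order_trans[OF sum_abs]) (auto intro!: sum_mono)
          finally have "left_point T ?H k i \<omega> = ?H (grid T k i) \<omega>"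
            unfolding left_point_def using False elim by (auto simp: min_def max_def)
          also have "\<dots> = (\<Sum>v\<in>?D. jump Y v \<omega> * of_bool (j v k \<le> i))"
            unfolding H j_def using D(2) less_grid_iff[OF T, of _ k i]
            by (intro sum.cong refl arg_cong2[where f="(*)"] arg_cong[where f=of_bool]) (auto simp: subset_iff)
          finally show ?thesis .
        qed
        define f where "f i = X (min (grid T k i) t) \<omega>" for i
        have "elementary_integral (Suc k) (grid T k) (left_point T ?H k) X t \<omega>
          = (\<Sum>i<Suc k. \<Sum>v\<in>?D. jump Y v \<omega> * (of_bool (j v k \<le> i) * (f (Suc i) - f i)))"
          unfolding elementary_integral_def f_def
          by (intro sum.cong refl) (simp add: lp sum_distrib_right mult.assoc)
        also have "\<dots> = (\<Sum>v\<in>?D. jump Y v \<omega> * (\<Sum>i<Suc k. of_bool (j v k \<le> i) * (f (Suc i) - f i)))"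
          unfolding sum_distrib_left by (rule sum.swap)
        also have "\<dots> = (\<Sum>v\<in>?D. jump Y v \<omega> * (f (Suc k) - f (min (j v k) (Suc k))))"
          unfolding sum_increments_from ..
        finally show ?case using t unfolding f_def r_def by simp
      qed
      moreover have "(\<lambda>k. \<Sum>v\<in>?D. jump Y v \<omega> * (X t \<omega> - X (min (r v k) t) \<omega>))
         \<longlonglongrightarrow> (\<Sum>v\<in>?D. jump Y v \<omega> * (X t \<omega> - X (min v t) \<omega>))"
        by (intro tendsto_sum tendsto_mult tendsto_const tendsto_diff lim)
      moreover have "(\<Sum>v\<in>?D. jump Y v \<omega> * (X t \<omega> - X (min v t) \<omega>))
         = (\<Sum>v\<in>?D \<inter> {..t}. jump Y v \<omega> * (X t \<omega> - X v \<omega>))"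
        using D(1) by (auto simp: sum.inter_restrict min_def intro!: sum.cong)
      ultimately show "(\<lambda>k. elementary_integral (Suc k) (grid T k) (left_point T ?H k) X t \<omega>)
        \<longlonglongrightarrow> (\<Sum>v\<in>?D \<inter> {..t}. jump Y v \<omega> * (X t \<omega> - X v \<omega>))"
        using Lim_transform_eventually by fastforce
    qed
  qed
qed

section \<open>Brackets with a pure-jump semimartingale\<close>

text \<open>The infinite sums over \<open>(0, t]\<close> in the definitions are finite whenever a factor with finitely many
  jumps is present.\<close>

lemma infsum_jump_times:
  assumes "finite (jump_times T X \<omega>)" "t \<le> T" "\<And>v. jump X v \<omega> = 0 \<Longrightarrow> g v = 0"
  shows "(\<Sum>\<^sub>\<infinity>u\<in>{0<..t}. g u) = (\<Sum>v\<in>jump_times T X \<omega> \<inter> {..t}. g v)"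
proof -
  have "(\<Sum>\<^sub>\<infinity>u\<in>{0<..t}. g u) = (\<Sum>\<^sub>\<infinity>u\<in>jump_times T X \<omega> \<inter> {..t}. g u)"
    by (rule infsum_cong_neutral) (use assms in \<open>auto simp: jump_times_def\<close>)
  then show ?thesis using assms(1) by simp
qed

lemma quadratic_covariation_commute:
  assumes "quadratic_covariation P F T X Y C"
  shows "quadratic_covariation P F T Y X C"
proof -
  obtain U V where C: "adapted_cadlag P F T C"
    and UV: "ito_integral P F T (left_limit X) Y U" "ito_integral P F T (left_limit Y) X V"
    and eq: "AE \<omega> in P. \<forall>t\<in>{0..T}. C t \<omega> = X t \<omega> * Y t \<omega> - X 0 \<omega> * Y 0 \<omega> - U t \<omega> - V t \<omega>"
    using assms unfolding quadratic_covariation_def by blast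
  from eq have "AE \<omega> in P. \<forall>t\<in>{0..T}. C t \<omega> = Y t \<omega> * X t \<omega> - Y 0 \<omega> * X 0 \<omega> - V t \<omega> - U t \<omega>"
    by eventually_elim (simp add: algebra_simps)
  with C UV show ?thesis unfolding quadratic_covariation_def by blast
qed

lemma continuous_covariation_commute:
  assumes "continuous_covariation P F T X Y D"
  shows "continuous_covariation P F T Y X D"
proof -
  obtain C where D: "adapted_cadlag P F T D" and C: "quadratic_covariation P F T X Y C"
    and eq: "AE \<omega> in P. \<forall>t\<in>{0..T}. D t \<omega> = C t \<omega> - (\<Sum>\<^sub>\<infinity>u\<in>{0<..t}. jump X u \<omega> * jump Y u \<omega>)"
    using assms unfolding continuous_covariation_def by blast
  from eq have "AE \<omega> in P. \<forall>t\<in>{0..T}. D t \<omega> = C t \<omega> - (\<Sum>\<^sub>\<infinity>u\<in>{0<..t}. jump Y u \<omega> * jump X u \<omega>)"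
    by (simp only: mult.commute)
  with D quadratic_covariation_commute[OF C] show ?thesis unfolding continuous_covariation_def by blast
qed

text \<open>Per jump time \<open>v\<close>, with \<open>\<Delta>Y\<^sub>v\<close> factored out, integration by parts leaves
  \<open>X\<^sub>t - X\<^sub>v\<^sub>- - (X\<^sub>t - X\<^sub>v) = \<Delta>X\<^sub>v\<close>, so that \<open>[X, Y] = \<Sum> \<Delta>X \<Delta>Y\<close> is exhausted by its jumps.\<close>

lemma continuous_covariation_pure_jump:
  assumes fps: "filtered_prob_space P F T" and cc: "continuous_covariation P F T X Y D"
    and Y: "AE \<omega> in P. pure_jump T Y \<omega>"
  shows "AE \<omega> in P. \<forall>t\<in>{0..T}. D t \<omega> = 0"
proof -
  have T: "0 < T" using fps unfolding filtered_prob_space_def by auto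
  obtain C U V where UV: "ito_integral P F T (left_limit X) Y U" "ito_integral P F T (left_limit Y) X V"
    and C: "AE \<omega> in P. \<forall>t\<in>{0..T}. C t \<omega> = X t \<omega> * Y t \<omega> - X 0 \<omega> * Y 0 \<omega> - U t \<omega> - V t \<omega>"
    and D: "AE \<omega> in P. \<forall>t\<in>{0..T}. D t \<omega> = C t \<omega> - (\<Sum>\<^sub>\<infinity>u\<in>{0<..t}. jump X u \<omega> * jump Y u \<omega>)"
    using cc unfolding continuous_covariation_def quadratic_covariation_def by blast
  from C D Y ito_integral_pure_jump_integrator[OF fps UV(1) Y] ito_integral_pure_jump_integrand[OF fps UV(2) Y]
  show ?thesis
  proof eventually_elim
    case (elim \<omega>)
    let ?J = "\<lambda>t. jump_times T Y \<omega> \<inter> {..t}"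
    have Yt: "Y t \<omega> = (\<Sum>v\<in>?J t. jump Y v \<omega>)" if "t \<in> {0..T}" for t
      using elim(3) that unfolding pure_jump_def by blast
    have fin: "finite (jump_times T Y \<omega>)" using elim(3) unfolding pure_jump_def by blast
    have "?J 0 = {}" using jump_times_subset[of T Y \<omega>] by force
    then have Y0: "Y 0 \<omega> = 0" using Yt[of 0] T by simp
    show ?case
    proof
      fix t assume t: "t \<in> {0..T}"
      have "(\<Sum>\<^sub>\<infinity>u\<in>{0<..t}. jump X u \<omega> * jump Y u \<omega>) = (\<Sum>v\<in>?J t. jump X v \<omega> * jump Y v \<omega>)"
        using t by (intro infsum_jump_times[OF fin]) auto
      then have "D t \<omega> = X t \<omega> * (\<Sum>v\<in>?J t. jump Y v \<omega>) - (\<Sum>v\<in>?J t. left_limit X v \<omega> * jump Y v \<omega>)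
          - (\<Sum>v\<in>?J t. jump Y v \<omega> * (X t \<omega> - X v \<omega>)) - (\<Sum>v\<in>?J t. jump X v \<omega> * jump Y v \<omega>)"
        using elim(1,2,4,5) t Yt[OF t] Y0 by simp
      also have "\<dots> = (\<Sum>v\<in>?J t. X t \<omega> * jump Y v \<omega> - left_limit X v \<omega> * jump Y v \<omega>
          - jump Y v \<omega> * (X t \<omega> - X v \<omega>) - jump X v \<omega> * jump Y v \<omega>)"
        by (simp add: sum_subtractf sum_distrib_left)
      also have "\<dots> = 0" by (rule sum.neutral) (simp add: jump_def[of X] algebra_simps)
      finally show "D t \<omega> = 0" .
    qed
  qed
qed

section \<open>Counting processes\<close>

lemma jump_nonneg:
  assumes X: "cadlag_on T (\<lambda>t. X t \<omega>)"
    and mono: "\<And>s t. 0 \<le> s \<Longrightarrow> s \<le> t \<Longrightarrow> t \<le> T \<Longrightarrow> X s \<omega> \<le> X t \<omega>" and u: "u \<in> {0<..T}"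
  shows "0 \<le> jump X u \<omega>"
proof -
  have "eventually (\<lambda>s. X s \<omega> \<le> X u \<omega>) (at_left u)"
    unfolding eventually_at_left_field using u by (intro exI[of _ 0]) (auto intro: mono)
  then have "left_limit X u \<omega> \<le> X u \<omega>"
    by (rule tendsto_upperbound[OF left_limit_tendsto[where X=X, OF X u]]) simp
  then show ?thesis by (simp add: jump_def)
qed

lemma jump_Ints:
  assumes X: "cadlag_on T (\<lambda>t. X t \<omega>)" and N: "\<And>t. t \<in> {0..T} \<Longrightarrow> X t \<omega> \<in> \<nat>"
    and u: "u \<in> {0<..T}"
  shows "jump X u \<omega> \<in> \<int>"
proof -
  have "eventually (\<lambda>s. X s \<omega> \<in> \<int>) (at_left u)"
    unfolding eventually_at_left_field using u N Nats_subset_Ints by (intro exI[of _ 0]) force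
  then have "left_limit X u \<omega> \<in> \<int>"
    by (rule Lim_in_closed_set[OF closed_Ints _ _ left_limit_tendsto[where X=X, OF X u]]) simp
  then show ?thesis unfolding jump_def using N[of u] u Nats_subset_Ints by auto
qed

text \<open>The jumps are nonnegative integers and their finite partial sums are bounded by the final value
  \<open>N\<^sub>T\<close>, so there are at most \<open>N\<^sub>T\<close> of them.\<close>

lemma counting_process_pure_jump:
  assumes T: "0 < T" and N: "counting_process P F T N" and w: "\<omega> \<in> space P"
  shows "pure_jump T N \<omega>"
proof -
  have c: "cadlag_on T (\<lambda>t. N t \<omega>)" and nat: "\<And>t. t \<in> {0..T} \<Longrightarrow> N t \<omega> \<in> \<nat>"
    and mono: "\<And>s t. 0 \<le> s \<Longrightarrow> s \<le> t \<Longrightarrow> t \<le> T \<Longrightarrow> N s \<omega> \<le> N t \<omega>"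
    and sum: "\<And>t. t \<in> {0..T} \<Longrightarrow> N t \<omega> = (\<Sum>\<^sub>\<infinity>u\<in>{0<..t}. jump N u \<omega>)" and zero: "N 0 \<omega> = 0"
    using N w unfolding counting_process_def adapted_cadlag_def by auto
  have pos: "0 \<le> jump N u \<omega>" if "u \<in> {0<..T}" for u
    by (rule jump_nonneg[where X=N, OF c mono that])
  have int: "jump N u \<omega> \<in> \<int>" if "u \<in> {0<..T}" for u
    by (rule jump_Ints[where X=N, OF c nat that])
  have fin: "finite (jump_times T N \<omega>)"
  \<comment> \<open>An infinite sum is \<open>0\<close> when it diverges, so \<open>N\<^sub>T \<noteq> 0\<close> is what makes the jumps summable.\<close>
  proof (cases "N T \<omega> = 0")
    case True
    have zero: "N t \<omega> = 0" if "t \<in> {0..T}" for t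
      using mono[of 0 t] mono[of t T] zero True that T by auto
    have "jump N u \<omega> = 0" if "u \<in> {0<..T}" for u
      by (rule trans[OF step_path_jump[of "{}" T N \<omega> "\<lambda>_. 0"]]) (use zero that in auto)
    then have "jump_times T N \<omega> = {}" unfolding jump_times_def by auto
    then show ?thesis by simp
  next
    case False
    then have summ: "(\<lambda>u. jump N u \<omega>) summable_on {0<..T}"
      using sum[of T] T infsum_not_exists by fastforce
    obtain n where n: "N T \<omega> = real n" using nat[of T] T by (auto elim: Nats_cases)
    have "card E \<le> n" if E: "E \<subseteq> jump_times T N \<omega>" "finite E" for E
    proof -
      have "real (card E) = (\<Sum>u\<in>E. 1)" by simp
      also have "\<dots> \<le> (\<Sum>u\<in>E. jump N u \<omega>)"
      proof (rule sum_mono)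
        fix u assume "u \<in> E"
        then have "u \<in> {0<..T}" "jump N u \<omega> \<noteq> 0" using E unfolding jump_times_def by auto
        then show "1 \<le> jump N u \<omega>" using pos[of u] int[of u] by (auto elim!: Ints_cases)
      qed
      also have "\<dots> \<le> (\<Sum>\<^sub>\<infinity>u\<in>{0<..T}. jump N u \<omega>)"
        using E(1) jump_times_subset[of T N \<omega>] pos by (intro finite_sum_le_infsum[OF summ E(2)]) auto
      also have "\<dots> = real n" using sum[of T] T n by simp
      finally show ?thesis by simp
    qed
    then show ?thesis using finite_if_finite_subsets_card_bdd by blast
  qed
  have "N t \<omega> = (\<Sum>v\<in>jump_times T N \<omega> \<inter> {..t}. jump N v \<omega>)" if "t \<in> {0..T}" for t
    using sum[OF that] infsum_jump_times[OF fin, of t "\<lambda>u. jump N u \<omega>"] that by simp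
  with fin show ?thesis unfolding pure_jump_def by blast
qed

lemma jump_power_sum_step:
  assumes fin: "finite (jump_times T N \<omega>)" and t: "t \<le> T" and m: "0 < m"
  shows "jump_power_sum m N t \<omega> = (\<Sum>v\<in>jump_times T N \<omega> \<inter> {..t}. jump N v \<omega> ^ m)"
  unfolding jump_power_sum_def using m by (intro infsum_jump_times[OF fin t]) simp

lemma jump_power_sum_jumps:
  assumes N: "pure_jump T N \<omega>" and m: "0 < m"
  shows "pure_jump T (jump_power_sum m N) \<omega>"
    and "u \<in> {0<..T} \<Longrightarrow> jump (jump_power_sum m N) u \<omega> = jump N u \<omega> ^ m"
    and "jump_times T (jump_power_sum m N) \<omega> = jump_times T N \<omega>"
proof -
  have fin: "finite (jump_times T N \<omega>)" using N unfolding pure_jump_def by blast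
  have step: "jump_power_sum m N t \<omega> = (\<Sum>v\<in>jump_times T N \<omega> \<inter> {..t}. jump N v \<omega> ^ m)" if "t \<in> {0..T}" for t
    using jump_power_sum_step[OF fin _ m] that by auto
  show "pure_jump T (jump_power_sum m N) \<omega>"
    by (rule step_path_pure_jump[where X="jump_power_sum m N" and \<omega>=\<omega>, OF fin jump_times_subset step])
  show j: "jump (jump_power_sum m N) u \<omega> = jump N u \<omega> ^ m" if u: "u \<in> {0<..T}" for u
    using step_path_jump[where X="jump_power_sum m N" and \<omega>=\<omega>, OF fin step u] u m unfolding jump_times_def by auto
  show "jump_times T (jump_power_sum m N) \<omega> = jump_times T N \<omega>"
    unfolding jump_times_def using j m by auto
qed

section \<open>Deconcatenation\<close>

lemma splits_eq: "splits J = (\<lambda>i. (take i J, drop i J)) ` {..length J}"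
proof -
  have "(A, B) \<in> (\<lambda>i. (take i J, drop i J)) ` {..length J}" if "A @ B = J" for A B
    using that by (intro image_eqI[of _ _ "length A"]) auto
  then show ?thesis unfolding splits_def by auto
qed

lemma finite_splits [simp]: "finite (splits J)"
  unfolding splits_eq by simp

lemma sum_splits_snoc:
  "(\<Sum>(A, B)\<in>splits (J @ [l]). f A B) = f (J @ [l]) [] + (\<Sum>(A, B)\<in>splits J. f A (B @ [l]))"
proof -
  have "splits (J @ [l]) = insert (J @ [l], []) ((\<lambda>(A, B). (A, B @ [l])) ` splits J)"
  proof (intro set_eqI iffI)
    fix p assume "p \<in> splits (J @ [l])"
    then obtain A B where p: "p = (A, B)" "A @ B = J @ [l]" unfolding splits_def by auto
    show "p \<in> insert (J @ [l], []) ((\<lambda>(A, B). (A, B @ [l])) ` splits J)"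
    proof (cases B rule: rev_cases)
      case (snoc B' x)
      then show ?thesis using p unfolding splits_def by (auto simp: image_iff)
    qed (use p in simp)
  qed (auto simp: splits_def)
  moreover have "inj_on (\<lambda>(A, B). (A, B @ [l])) (splits J)" by (auto simp: inj_on_def)
  moreover have "(J @ [l], []) \<notin> (\<lambda>(A, B). (A, B @ [l])) ` splits J" by auto
  ultimately show ?thesis
    by (simp add: sum.reindex case_prod_unfold)
qed

lemma sum_splits_Nil:
  fixes f :: "'i list \<Rightarrow> 'i list \<Rightarrow> real"
  shows "(\<Sum>(A, B)\<in>splits J. f A B) = f J [] + (\<Sum>(A, B)\<in>splits J. of_bool (B \<noteq> []) * f A B)"
proof -
  have mem: "(J, []) \<in> splits J" by (simp add: splits_def)
  have "(\<Sum>(A, B)\<in>splits J. f A B) = f J [] + (\<Sum>(A, B)\<in>splits J - {(J, [])}. f A B)"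
    using sum.remove[OF finite_splits mem, of "\<lambda>(A, B). f A B"] by simp
  also have "(\<Sum>(A, B)\<in>splits J - {(J, [])}. f A B) = (\<Sum>(A, B)\<in>splits J. of_bool (B \<noteq> []) * f A B)"
    by (rule sum.mono_neutral_cong_left[OF finite_splits]) (auto simp: splits_def)
  finally show ?thesis .
qed

text \<open>Both sides sum over all ways to cut \<open>J\<close> into three consecutive words.\<close>

lemma sum_splits_coassoc:
  "(\<Sum>(AB, C)\<in>splits J. \<Sum>(A, B)\<in>splits AB. g A B C) = (\<Sum>(A, BC)\<in>splits J. \<Sum>(B, C)\<in>splits BC. g A B C)"
proof -
  have "(\<Sum>(AB, C)\<in>splits J. \<Sum>(A, B)\<in>splits AB. g A B C)
    = (\<Sum>(p, q)\<in>Sigma (splits J) (\<lambda>p. splits (fst p)). g (fst q) (snd q) (snd p))"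
    by (simp add: sum.Sigma case_prod_unfold)
  also have "\<dots> = (\<Sum>(p, q)\<in>Sigma (splits J) (\<lambda>p. splits (snd p)). g (fst p) (fst q) (snd q))"
    by (rule sum.reindex_bij_witness[of _ "\<lambda>(p, q). ((fst p @ fst q, snd q), (fst p, fst q))"
          "\<lambda>(p, q). ((fst q, snd q @ snd p), (snd q, snd p))"]) (auto simp: splits_def)
  also have "\<dots> = (\<Sum>(A, BC)\<in>splits J. \<Sum>(B, C)\<in>splits BC. g A B C)"
    by (simp add: sum.Sigma case_prod_unfold)
  finally show ?thesis .
qed

lemma sum_splits_length:
  "(\<Sum>(A, B)\<in>splits J. f (length A) (length B)) = (\<Sum>i\<le>length J. f i (length J - i))"
proof -
  have "inj_on (\<lambda>i. (take i J, drop i J)) {..length J}"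
    by (rule inj_onI) (metis Pair_inject atMost_iff length_take min_absorb2)
  then show ?thesis unfolding splits_eq by (simp add: sum.reindex)
qed

section \<open>The coefficients of the tilde transform\<close>

lemma compositions_0: "compositions r 0 = (if r = 0 then {[]} else {})"
  unfolding compositions_def by auto

text \<open>Splitting off the first part; this is the source of the recursion for \<open>\<alpha>(r, k)\<close>.\<close>

lemma compositions_Suc:
  "compositions r (Suc k) = (\<Union>i\<in>{1..r}. (#) i ` compositions (r - i) k)"
proof (intro set_eqI iffI)
  fix xs assume xs: "xs \<in> compositions r (Suc k)"
  then obtain i ys where "xs = i # ys" unfolding compositions_def by (cases xs) auto
  then show "xs \<in> (\<Union>i\<in>{1..r}. (#) i ` compositions (r - i) k)"
    using xs unfolding compositions_def by (intro UN_I[of i] image_eqI[of _ _ ys]) auto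
qed (auto simp: compositions_def)

lemma finite_compositions [simp]: "finite (compositions r k)"
  by (induction k arbitrary: r) (simp_all add: compositions_0 compositions_Suc)

lemma alpha2_0: "alpha2 r 0 = of_bool (r = 0)"
  by (simp add: alpha2_def compositions_0)

lemma alpha2_Suc: "alpha2 r (Suc k) = (\<Sum>i=1..r. 1 / fact (i + 1) * alpha2 (r - i) k)"
proof -
  have "alpha2 r (Suc k) = (\<Sum>i=1..r. \<Sum>is\<in>(#) i ` compositions (r - i) k. \<Prod>j\<leftarrow>is. 1 / fact (j + 1))"
    unfolding alpha2_def compositions_Suc by (rule sum.UNION_disjoint) auto
  also have "\<dots> = (\<Sum>i=1..r. 1 / fact (i + 1) * alpha2 (r - i) k)"
    unfolding alpha2_def by (intro sum.cong refl) (simp add: sum.reindex sum_distrib_left)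
  finally show ?thesis .
qed

lemma alpha2_eq_0: "r < k \<Longrightarrow> alpha2 r k = 0"
proof (induction k arbitrary: r)
  case (Suc k)
  then show ?case unfolding alpha2_Suc by (intro sum.neutral ballI) auto
qed simp

text \<open>The coefficient of \<open>\<epsilon>\<^sub>J \<otimes> \<epsilon>\<^sub>j\<close> itself in the tilde transform belongs to the empty suffix. Including it
  as \<open>\<alpha>(0) = 1\<close> gives the Taylor coefficients of \<open>x / (e\<^sup>x - 1)\<close>.\<close>

definition alpha0 :: "nat \<Rightarrow> real" where
  "alpha0 r = (if r = 0 then 1 else alpha r)"

lemma alpha0_eq: "n \<ge> r \<Longrightarrow> alpha0 r = (\<Sum>k\<le>n. (-1) ^ k * alpha2 r k)"
proof -
  assume n: "n \<ge> r"
  have "(\<Sum>k\<le>n. (-1) ^ k * alpha2 r k) = (\<Sum>k\<le>r. (-1) ^ k * alpha2 r k)"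
    using n by (intro sum.mono_neutral_right) (auto simp: alpha2_eq_0)
  also have "\<dots> = alpha2 r 0 + alpha r"
    unfolding alpha_def by (simp add: atMost_atLeast0 sum.atLeast_Suc_atMost)
  finally show ?thesis unfolding alpha0_def alpha2_0 by (simp add: alpha_def)
qed

text \<open>With \<open>h(x) = \<Sum>\<^sub>i\<^sub>\<ge>\<^sub>1 x\<^sup>i / (i + 1)!\<close>, the number \<open>\<alpha>(r, k)\<close> is the coefficient of \<open>x\<^sup>r\<close> in \<open>h(x)\<^sup>k\<close>, hence
  \<open>alpha0\<close> lists the coefficients of the geometric series \<open>1 / (1 + h(x))\<close>, and the claim is
  \<open>(1 + h(x)) \<cdot> 1 / (1 + h(x)) = 1\<close>. On coefficients: peeling the first part off each composition
  turns the alternating sum for \<open>\<alpha>(n)\<close> into minus the remaining terms of the convolution.\<close>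

lemma alpha0_convolution: "(\<Sum>i\<le>n. alpha0 (n - i) / fact (i + 1)) = of_bool (n = 0)"
proof (cases n)
  case 0 then show ?thesis by (simp add: alpha0_def)
next
  case (Suc m)
  have "alpha0 n = (\<Sum>k\<le>Suc m. (-1) ^ k * alpha2 n k)" by (rule alpha0_eq) (simp add: Suc)
  also have "\<dots> = (\<Sum>k\<le>m. (-1) ^ Suc k * alpha2 n (Suc k))"
    by (subst sum.atMost_Suc_shift) (simp add: alpha2_0 Suc)
  also have "\<dots> = (\<Sum>k\<le>m. \<Sum>i=1..n. - (1 / fact (i + 1)) * ((-1) ^ k * alpha2 (n - i) k))"
    unfolding alpha2_Suc sum_distrib_left by (intro sum.cong refl) simp
  also have "\<dots> = (\<Sum>i=1..n. - (1 / fact (i + 1)) * (\<Sum>k\<le>m. (-1) ^ k * alpha2 (n - i) k))"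
    unfolding sum_distrib_left by (rule sum.swap)
  also have "\<dots> = (\<Sum>i=1..n. - (1 / fact (i + 1)) * alpha0 (n - i))"
    using Suc by (intro sum.cong refl arg_cong2[where f="(*)"] alpha0_eq[symmetric]) auto
  also have "\<dots> = - (\<Sum>i=1..n. alpha0 (n - i) / fact (i + 1))"
    by (simp add: sum_negf)
  finally have "alpha0 n + (\<Sum>i=1..n. alpha0 (n - i) / fact (i + 1)) = 0" by simp
  moreover have "(\<Sum>i\<le>n. alpha0 (n - i) / fact (i + 1)) = alpha0 n + (\<Sum>i=1..n. alpha0 (n - i) / fact (i + 1))"
    by (simp add: atMost_atLeast0 sum.atLeast_Suc_atMost)
  ultimately show ?thesis using Suc by simp
qed

section \<open>Pairings\<close>

lemma pairing_superset:
  "finite A \<Longrightarrow> Poly_Mapping.keys u \<subseteq> A \<Longrightarrow> pairing u x = (\<Sum>J\<in>A. Poly_Mapping.lookup u J * x J)"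
  unfolding pairing_def by (rule sum.mono_neutral_left) (auto simp: in_keys_iff)

lemma pairing_add: "pairing (u + v) x = pairing u x + pairing v x"
proof -
  let ?A = "Poly_Mapping.keys u \<union> Poly_Mapping.keys v"
  have "Poly_Mapping.keys (u + v) \<subseteq> ?A" by (rule Poly_Mapping.keys_add)
  then show ?thesis
    by (simp add: pairing_superset[of ?A] lookup_add distrib_right sum.distrib)
qed

lemma pairing_diff: "pairing (u - v) x = pairing u x - pairing v x"
  using pairing_add[of "u - v" v x] by simp

lemma pairing_0 [simp]: "pairing 0 x = 0"
  by (simp add: pairing_def)

lemma pairing_sum: "pairing (\<Sum>i\<in>A. u i) x = (\<Sum>i\<in>A. pairing (u i) x)"
  by (induction A rule: infinite_finite_induct) (simp_all add: pairing_add)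

lemma pairing_eps [simp]: "pairing (eps J) x = x J"
  by (simp add: pairing_def eps_def)

lemma lookup_scale: "Poly_Mapping.lookup (scale c u) J = c * Poly_Mapping.lookup u J"
  unfolding scale_def by (simp add: map.rep_eq when_def)

lemma pairing_scale [simp]: "pairing (scale c u) x = c * pairing u x"
proof -
  have "Poly_Mapping.keys (scale c u) \<subseteq> Poly_Mapping.keys u"
    by (auto simp: in_keys_iff lookup_scale)
  then show ?thesis
    by (simp add: pairing_superset[of "Poly_Mapping.keys u"] lookup_scale sum_distrib_left mult.assoc)
qed

lemma pairing_tilde: "pairing (tilde u j) x = pairing u (\<lambda>J. pairing (tilde_word J j) x)"
  unfolding tilde_def pairing_sum pairing_scale unfolding pairing_def ..

text \<open>The common shape of the ask and the bid part of the tilde transform, as one sum over all suffixes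
  including the empty one.\<close>

lemma tilde_suffix_sum:
  "x (J @ [c 1]) + (\<Sum>(A, B)\<in>{(A, B)\<in>splits J. B \<noteq> []}.
      if set B = {c 1} then alpha (length B) * x (A @ [c (length B + 1)]) else 0)
    = (\<Sum>(A, B)\<in>splits J. of_bool (set B \<subseteq> {c 1}) * (alpha0 (length B) * x (A @ [c (length B + 1)])))"
proof -
  have "(\<Sum>(A, B)\<in>{(A, B)\<in>splits J. B \<noteq> []}.
      if set B = {c 1} then alpha (length B) * x (A @ [c (length B + 1)]) else 0)
    = (\<Sum>(A, B)\<in>splits J. of_bool (B \<noteq> []) *
        (of_bool (set B \<subseteq> {c 1}) * (alpha0 (length B) * x (A @ [c (length B + 1)]))))"
    by (rule sum.mono_neutral_cong_left) (auto simp: alpha0_def subset_singleton_iff)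
  then show ?thesis
    by (subst sum_splits_Nil) (simp add: alpha0_def)
qed

lemma pairing_tilde_word_Ask:
  "pairing (tilde_word J (Ask 1)) x =
    (\<Sum>(A, B)\<in>splits J. of_bool (set B \<subseteq> {Ask 1}) * (alpha0 (length B) * x (A @ [Ask (length B + 1)])))"
proof -
  have "pairing (tilde_word J (Ask 1)) x = x (J @ [Ask 1]) + (\<Sum>(A, B)\<in>{(A, B)\<in>splits J. B \<noteq> []}.
      if set B = {Ask 1} then alpha (length B) * x (A @ [Ask (length B + 1)]) else 0)"
    unfolding tilde_word_def
    by (simp add: pairing_add pairing_diff pairing_sum case_prod_unfold if_distrib[of "\<lambda>u. pairing u x"] cong: if_cong)
  then show ?thesis by (simp only: tilde_suffix_sum)
qed

lemma pairing_tilde_word_Bid: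
  "pairing (tilde_word J (Bid 1)) x =
    (\<Sum>(A, B)\<in>splits J. of_bool (set B \<subseteq> {Bid 1}) * (alpha0 (length B) * x (A @ [Bid (length B + 1)])))"
proof -
  have "pairing (tilde_word J (Bid 1)) x = x (J @ [Bid 1]) + (\<Sum>(A, B)\<in>{(A, B)\<in>splits J. B \<noteq> []}.
      if set B = {Bid 1} then alpha (length B) * x (A @ [Bid (length B + 1)]) else 0)"
    unfolding tilde_word_def
    by (simp add: pairing_add pairing_diff pairing_sum case_prod_unfold if_distrib[of "\<lambda>u. pairing u x"] cong: if_cong)
  then show ?thesis by (simp only: tilde_suffix_sum)
qed

lemma pairing_tilde_word_Mid:
  "J = [] \<or> last J \<noteq> Mid \<Longrightarrow> pairing (tilde_word J Mid) x = x (J @ [Mid])"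
  unfolding tilde_word_def
  by (auto simp: pairing_add pairing_diff pairing_sum case_prod_unfold)

section \<open>The signature along a pure-jump letter\<close>

lemma ito_integral_zero_integrator:
  assumes fps: "filtered_prob_space P F T" and ito: "ito_integral P F T H X U"
    and X: "AE \<omega> in P. \<forall>t\<in>{0..T}. X t \<omega> = 0"
  shows "AE \<omega> in P. \<forall>t\<in>{0..T}. U t \<omega> = 0"
proof -
  have X0: "pure_jump T X \<omega> \<and> jump_times T X \<omega> = {}" if "\<forall>t\<in>{0..T}. X t \<omega> = 0" for \<omega>
    using step_path_pure_jump[of "{}" T X \<omega> "\<lambda>_. 0"] step_path_jump[of "{}" T X \<omega> "\<lambda>_. 0"] that
    unfolding jump_times_def by auto
  have "AE \<omega> in P. pure_jump T X \<omega>" using X by eventually_elim (use X0 in blast)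
  from ito_integral_pure_jump_integrator[OF fps ito this] X show ?thesis
    by eventually_elim (use X0 in simp)
qed

text \<open>When the bracket of the last two letters has a pure-jump factor, the half-bracket term of the signature is
  an integral against \<open>0\<close>. In the jump part only the suffixes \<open>J\<^sub>2 l\<close> with nonempty \<open>J\<^sub>2\<close> remain.\<close>

lemma signature_snoc_without_bracket:
  assumes fps: "filtered_prob_space P F T" and sig: "is_signature P F T A X Sig"
    and J: "J \<in> lists A" and l: "l \<in> A"
    and pj: "J \<noteq> [] \<Longrightarrow> (AE \<omega> in P. pure_jump T (X (last J)) \<omega>) \<or> (AE \<omega> in P. pure_jump T (X l) \<omega>)"
  obtains U where "ito_integral P F T (left_limit (Sig J)) (X l) U"
    and "AE \<omega> in P. \<forall>t\<in>{0..T}. Sig (J @ [l]) t \<omega> = U t \<omega> +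
      (\<Sum>\<^sub>\<infinity>u\<in>{0<..t}. \<Sum>(J1, J2)\<in>splits J. of_bool (J2 \<noteq> []) *
        (1 / fact (length J2 + 1) * left_limit (Sig J1) u \<omega> * (\<Prod>j\<leftarrow>J2. jump (X j) u \<omega>) * jump (X l) u \<omega>))"
proof -
  have "J @ [l] \<in> lists A" using J l by auto
  then have "\<exists>U V. ito_integral P F T (left_limit (Sig (butlast (J @ [l])))) (X (last (J @ [l]))) U \<and>
      (if length (J @ [l]) > 1
       then \<exists>D. continuous_covariation P F T (X (last (butlast (J @ [l])))) (X (last (J @ [l]))) D \<and>
              ito_integral P F T (left_limit (Sig (butlast (butlast (J @ [l]))))) D V
       else V = (\<lambda>_ _. 0)) \<and>
      (AE \<omega> in P. \<forall>t\<in>{0..T}. Sig (J @ [l]) t \<omega> = U t \<omega> + 1 / 2 * V t \<omega>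
         + (\<Sum>\<^sub>\<infinity>u\<in>{0<..t}. \<Sum>(J1, J2)\<in>splits (J @ [l]).
              1 / fact (length J2) * of_bool (length J2 > 1) *
              left_limit (Sig J1) u \<omega> * (\<Prod>j\<leftarrow>J2. jump (X j) u \<omega>)))"
    using sig unfolding is_signature_def by blast
  then obtain U V where U: "ito_integral P F T (left_limit (Sig J)) (X l) U"
    and V: "if length (J @ [l]) > 1 then \<exists>D. continuous_covariation P F T (X (last J)) (X l) D \<and>
                     ito_integral P F T (left_limit (Sig (butlast J))) D V
            else V = (\<lambda>_ _. 0)"
    and eq: "AE \<omega> in P. \<forall>t\<in>{0..T}. Sig (J @ [l]) t \<omega> = U t \<omega> + 1 / 2 * V t \<omega>
                + (\<Sum>\<^sub>\<infinity>u\<in>{0<..t}. \<Sum>(J1, J2)\<in>splits (J @ [l]).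
                     1 / fact (length J2) * of_bool (length J2 > 1) *
                     left_limit (Sig J1) u \<omega> * (\<Prod>j\<leftarrow>J2. jump (X j) u \<omega>))"
    unfolding butlast_snoc last_snoc by blast
  have "AE \<omega> in P. \<forall>t\<in>{0..T}. V t \<omega> = 0"
  proof (cases "J = []")
    case False
    then obtain D where D: "continuous_covariation P F T (X (last J)) (X l) D"
      and DV: "ito_integral P F T (left_limit (Sig (butlast J))) D V" using V by auto
    have "AE \<omega> in P. \<forall>t\<in>{0..T}. D t \<omega> = 0"
      using pj[OF False] continuous_covariation_pure_jump[OF fps D]
        continuous_covariation_pure_jump[OF fps continuous_covariation_commute[OF D]] by blast
    then show ?thesis by (rule ito_integral_zero_integrator[OF fps DV])
  qed (use V in simp)
  with eq have "AE \<omega> in P. \<forall>t\<in>{0..T}. Sig (J @ [l]) t \<omega> = U t \<omega> +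
      (\<Sum>\<^sub>\<infinity>u\<in>{0<..t}. \<Sum>(J1, J2)\<in>splits J. of_bool (J2 \<noteq> []) *
        (1 / fact (length J2 + 1) * left_limit (Sig J1) u \<omega> * (\<Prod>j\<leftarrow>J2. jump (X j) u \<omega>) * jump (X l) u \<omega>))"
    by eventually_elim (simp add: sum_splits_snoc mult_ac)
  with U show ?thesis using that by blast
qed

text \<open>The integral against a pure-jump letter is exactly the summand that the jump part lacks, the one
  with the suffix of length one, so both merge into a single sum over all nonempty suffixes.\<close>

lemma signature_snoc_pure_jump:
  assumes fps: "filtered_prob_space P F T" and sig: "is_signature P F T A X Sig"
    and J: "J \<in> lists A" and l: "l \<in> A" and pj: "AE \<omega> in P. pure_jump T (X l) \<omega>"
  shows "AE \<omega> in P. \<forall>t\<in>{0..T}. Sig (J @ [l]) t \<omega> =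
    (\<Sum>v\<in>jump_times T (X l) \<omega> \<inter> {..t}. \<Sum>(J1, J2)\<in>splits J.
       1 / fact (length J2 + 1) * left_limit (Sig J1) v \<omega> * (\<Prod>j\<leftarrow>J2. jump (X j) v \<omega>) * jump (X l) v \<omega>)"
proof -
  let ?g = "\<lambda>\<omega> v J1 J2. 1 / fact (length J2 + 1) * left_limit (Sig J1) v \<omega> *
      (\<Prod>j\<leftarrow>J2. jump (X j) v \<omega>) * jump (X l) v \<omega>"
  obtain U where U: "ito_integral P F T (left_limit (Sig J)) (X l) U"
    and eq: "AE \<omega> in P. \<forall>t\<in>{0..T}. Sig (J @ [l]) t \<omega> = U t \<omega> +
      (\<Sum>\<^sub>\<infinity>u\<in>{0<..t}. \<Sum>(J1, J2)\<in>splits J. of_bool (J2 \<noteq> []) * ?g \<omega> u J1 J2)"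
    by (rule signature_snoc_without_bracket[OF fps sig J l disjI2[OF pj]])
  from eq pj ito_integral_pure_jump_integrator[OF fps U pj] show ?thesis
  proof eventually_elim
    case (elim \<omega>)
    show ?case
    proof
      fix t assume t: "t \<in> {0..T}"
      have fin: "finite (jump_times T (X l) \<omega>)" using elim unfolding pure_jump_def by blast
      have "(\<Sum>\<^sub>\<infinity>u\<in>{0<..t}. \<Sum>(J1, J2)\<in>splits J. of_bool (J2 \<noteq> []) * ?g \<omega> u J1 J2)
        = (\<Sum>v\<in>jump_times T (X l) \<omega> \<inter> {..t}. \<Sum>(J1, J2)\<in>splits J. of_bool (J2 \<noteq> []) * ?g \<omega> v J1 J2)"
        using t by (intro infsum_jump_times[OF fin]) (auto intro: sum.neutral)
      then have "Sig (J @ [l]) t \<omega> = (\<Sum>v\<in>jump_times T (X l) \<omega> \<inter> {..t}. ?g \<omega> v J [] +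
          (\<Sum>(J1, J2)\<in>splits J. of_bool (J2 \<noteq> []) * ?g \<omega> v J1 J2))"
        using elim t by (simp add: sum.distrib)
      then show "Sig (J @ [l]) t \<omega> = (\<Sum>v\<in>jump_times T (X l) \<omega> \<inter> {..t}. \<Sum>(J1, J2)\<in>splits J. ?g \<omega> v J1 J2)"
        by (simp only: sum_splits_Nil[symmetric, where f="?g \<omega> _"])
    qed
  qed
qed

lemma prod_list_jumps:
  fixes \<Delta> :: "'i \<Rightarrow> real"
  assumes "\<And>j. j \<in> set B \<Longrightarrow> j \<noteq> a \<Longrightarrow> \<Delta> j = 0"
  shows "(\<Prod>j\<leftarrow>B. \<Delta> j) = of_bool (set B \<subseteq> {a}) * \<Delta> a ^ length B"
  using assms by (induction B) auto

text \<open>The heart of the argument, for a generic letter \<open>c 1\<close> with power letters \<open>c m\<close>. Each coordinate on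
  the right is expanded over the jumps of \<open>c 1\<close>. Cutting \<open>J\<close> into \<open>J\<^sub>1 J\<^sub>2 J\<^sub>3\<close>, where \<open>J\<^sub>3\<close> comes from the
  tilde transform and \<open>J\<^sub>2\<close> from the jump part of the signature, the summand depends on \<open>J\<^sub>1\<close> and on the
  joint suffix \<open>J\<^sub>2 J\<^sub>3\<close> apart from the weight \<open>alpha0 \<bar>J\<^sub>3\<bar> / (\<bar>J\<^sub>2\<bar> + 1)!\<close>. Summing the weights first
  leaves only the empty joint suffix.\<close>

lemma ito_integral_signature_tilde:
  fixes c :: "nat \<Rightarrow> 'i"
  assumes fps: "filtered_prob_space P F T" and sig: "is_signature P F T A X Sig"
    and B: "B \<subseteq> A" and c: "\<And>m. m \<in> {1..M} \<Longrightarrow> c m \<in> A"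
    and N: "AE \<omega> in P. pure_jump T (X (c 1)) \<omega>"
    and powers: "\<And>m. m \<in> {1..M} \<Longrightarrow> X (c m) = (if m = 1 then X (c 1) else jump_power_sum m (X (c 1)))"
    and others: "AE \<omega> in P. \<forall>v\<in>jump_times T (X (c 1)) \<omega>. \<forall>j\<in>B. j \<noteq> c 1 \<longrightarrow> jump (X j) v \<omega> = 0"
    and J: "J \<in> lists B" "length J + 1 \<le> M"
  shows "AE \<omega> in P. \<forall>t\<in>{0..T}.
    (\<Sum>v\<in>jump_times T (X (c 1)) \<omega> \<inter> {..t}. left_limit (Sig J) v \<omega> * jump (X (c 1)) v \<omega>) =
    (\<Sum>(J1, J2)\<in>splits J. of_bool (set J2 \<subseteq> {c 1}) *
       (alpha0 (length J2) * Sig (J1 @ [c (length J2 + 1)]) t \<omega>))"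
proof -
  let ?N = "X (c 1)"
  let ?w = "\<lambda>\<omega> v m J1 J2. of_bool (set J2 \<subseteq> {c 1}) / fact (length J2 + 1) * left_limit (Sig J1) v \<omega> * jump ?N v \<omega> ^ (length J2 + m)"
  \<comment> \<open>At a jump of \<open>c 1\<close> a word of base letters has a nonzero jump product only if it is a power of \<open>c 1\<close>.\<close>
  have step: "AE \<omega> in P. \<forall>t\<in>{0..T}. Sig (I @ [c m]) t \<omega> =
      (\<Sum>v\<in>jump_times T ?N \<omega> \<inter> {..t}. \<Sum>(J1, J2)\<in>splits I. ?w \<omega> v m J1 J2)"
    if I: "I \<in> lists B" and m: "m \<in> {1..M}" for I m
  proof -
    have jumps: "pure_jump T (X (c m)) \<omega> \<and> jump_times T (X (c m)) \<omega> = jump_times T ?N \<omega> \<and>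
        (\<forall>v\<in>{0<..T}. jump (X (c m)) v \<omega> = jump ?N v \<omega> ^ m)" if "pure_jump T ?N \<omega>" for \<omega>
      using jump_power_sum_jumps[OF that, of m] m that powers[OF m] by auto
    have "AE \<omega> in P. pure_jump T (X (c m)) \<omega>" using N by eventually_elim (use jumps in blast)
    moreover have "I \<in> lists A" using I B by auto
    ultimately have "AE \<omega> in P. \<forall>t\<in>{0..T}. Sig (I @ [c m]) t \<omega> =
      (\<Sum>v\<in>jump_times T (X (c m)) \<omega> \<inter> {..t}. \<Sum>(J1, J2)\<in>splits I.
         1 / fact (length J2 + 1) * left_limit (Sig J1) v \<omega> * (\<Prod>j\<leftarrow>J2. jump (X j) v \<omega>) * jump (X (c m)) v \<omega>)"
      using c[OF m] by (intro signature_snoc_pure_jump[OF fps sig])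
    with N others show ?thesis
    proof eventually_elim
      case (elim \<omega>)
      have "1 / fact (length J2 + 1) * left_limit (Sig J1) v \<omega> * (\<Prod>j\<leftarrow>J2. jump (X j) v \<omega>) * jump (X (c m)) v \<omega>
        = ?w \<omega> v m J1 J2" if v: "v \<in> jump_times T ?N \<omega>" and sp: "(J1, J2) \<in> splits I" for v J1 J2
      proof -
        have "set J2 \<subseteq> B" using sp I unfolding splits_def by auto
        then have "(\<Prod>j\<leftarrow>J2. jump (X j) v \<omega>) = of_bool (set J2 \<subseteq> {c 1}) * jump ?N v \<omega> ^ length J2"
          using elim(2) v by (intro prod_list_jumps) blast
        moreover have "jump (X (c m)) v \<omega> = jump ?N v \<omega> ^ m"
          using jumps[OF elim(1)] v unfolding jump_times_def by blast
        ultimately show ?thesis by (simp add: power_add)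
      qed
      then have "(\<Sum>v\<in>jump_times T ?N \<omega> \<inter> {..t}. \<Sum>(J1, J2)\<in>splits I.
         1 / fact (length J2 + 1) * left_limit (Sig J1) v \<omega> * (\<Prod>j\<leftarrow>J2. jump (X j) v \<omega>) * jump (X (c m)) v \<omega>)
        = (\<Sum>v\<in>jump_times T ?N \<omega> \<inter> {..t}. \<Sum>(J1, J2)\<in>splits I. ?w \<omega> v m J1 J2)" for t
        by (intro sum.cong refl) auto
      then show ?case using elim(3) jumps[OF elim(1)] by simp
    qed
  qed
  have "AE \<omega> in P. \<forall>p\<in>splits J. \<forall>t\<in>{0..T}. Sig (fst p @ [c (length (snd p) + 1)]) t \<omega> =
      (\<Sum>v\<in>jump_times T ?N \<omega> \<inter> {..t}. \<Sum>(J1, J2)\<in>splits (fst p). ?w \<omega> v (length (snd p) + 1) J1 J2)"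
    using J by (intro AE_finite_allI finite_splits step) (auto simp: splits_def)
  then show ?thesis
  proof eventually_elim
    case (elim \<omega>)
    show ?case
    proof
      fix t assume t: "t \<in> {0..T}"
      let ?D = "jump_times T ?N \<omega> \<inter> {..t}"
      let ?h = "\<lambda>v J1 J2 J3. of_bool (set (J2 @ J3) \<subseteq> {c 1}) * left_limit (Sig J1) v \<omega> *
        jump ?N v \<omega> ^ (length (J2 @ J3) + 1) * (alpha0 (length J3) / fact (length J2 + 1))"
      have "(\<Sum>(I, J3)\<in>splits J. of_bool (set J3 \<subseteq> {c 1}) * (alpha0 (length J3) * Sig (I @ [c (length J3 + 1)]) t \<omega>))
        = (\<Sum>(I, J3)\<in>splits J. \<Sum>v\<in>?D. \<Sum>(J1, J2)\<in>splits I. ?h v J1 J2 J3)"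
      proof (intro sum.cong refl, clarify)
        fix I J3 assume "(I, J3) \<in> splits J"
        then have "Sig (I @ [c (length J3 + 1)]) t \<omega> = (\<Sum>v\<in>?D. \<Sum>(J1, J2)\<in>splits I. ?w \<omega> v (length J3 + 1) J1 J2)"
          using elim t by fastforce
        then show "of_bool (set J3 \<subseteq> {c 1}) * (alpha0 (length J3) * Sig (I @ [c (length J3 + 1)]) t \<omega>)
          = (\<Sum>v\<in>?D. \<Sum>(J1, J2)\<in>splits I. ?h v J1 J2 J3)"
          by (simp only: sum_distrib_left, intro sum.cong refl) (auto simp: algebra_simps power_add)
      qed
      also have "\<dots> = (\<Sum>v\<in>?D. \<Sum>(I, J3)\<in>splits J. \<Sum>(J1, J2)\<in>splits I. ?h v J1 J2 J3)"
        unfolding case_prod_unfold by (rule sum.swap)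
      \<comment> \<open>Regroup the cuts so that the joint suffix \<open>E = J2 @ J3\<close> is fixed.\<close>
      also have "\<dots> = (\<Sum>v\<in>?D. \<Sum>(J1, E)\<in>splits J. \<Sum>(J2, J3)\<in>splits E. ?h v J1 J2 J3)"
        by (simp only: sum_splits_coassoc)
      also have "\<dots> = (\<Sum>v\<in>?D. left_limit (Sig J) v \<omega> * jump ?N v \<omega>)"
      proof (intro sum.cong refl)
        fix v
        have "(\<Sum>(J1, E)\<in>splits J. \<Sum>(J2, J3)\<in>splits E. ?h v J1 J2 J3)
          = (\<Sum>(J1, E)\<in>splits J. of_bool (set E \<subseteq> {c 1}) * left_limit (Sig J1) v \<omega> * jump ?N v \<omega> ^ (length E + 1) *
              (\<Sum>(J2, J3)\<in>splits E. alpha0 (length J3) / fact (length J2 + 1)))"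
          unfolding sum_distrib_left by (intro sum.cong refl, clarify, intro sum.cong refl) (auto simp: splits_def)
        also have "\<dots> = (\<Sum>(J1, E)\<in>splits J. of_bool (set E \<subseteq> {c 1}) * left_limit (Sig J1) v \<omega> * jump ?N v \<omega> ^ (length E + 1) *
              of_bool (E = []))"
          by (simp only: sum_splits_length[where f="\<lambda>i k. alpha0 k / fact (i + 1)"] alpha0_convolution length_0_conv)
        also have "\<dots> = left_limit (Sig J) v \<omega> * jump ?N v \<omega>"
          by (subst sum_splits_Nil) (auto intro!: sum.neutral)
        finally show "(\<Sum>(J1, E)\<in>splits J. \<Sum>(J2, J3)\<in>splits E. ?h v J1 J2 J3) = left_limit (Sig J) v \<omega> * jump ?N v \<omega>" .
      qed
      finally show "(\<Sum>v\<in>?D. left_limit (Sig J) v \<omega> * jump ?N v \<omega>) =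
        (\<Sum>(J1, J2)\<in>splits J. of_bool (set J2 \<subseteq> {c 1}) * (alpha0 (length J2) * Sig (J1 @ [c (length J2 + 1)]) t \<omega>))"
        by simp
    qed
  qed
qed

section \<open>Execution revenue\<close>

lemma sig_linear_left_limit:
  assumes "\<And>J. J \<in> Poly_Mapping.keys u \<Longrightarrow> cadlag_on T (\<lambda>t. Sig J t \<omega>)" and v: "v \<in> {0<..T}"
  shows "left_limit (sig_linear u Sig) v \<omega> = pairing u (\<lambda>J. left_limit (Sig J) v \<omega>)"
proof (rule left_limitI)
  show "((\<lambda>s. sig_linear u Sig s \<omega>) \<longlongrightarrow> pairing u (\<lambda>J. left_limit (Sig J) v \<omega>)) (at_left v)"
    unfolding sig_linear_def pairing_def
    by (intro tendsto_sum tendsto_mult_left left_limit_tendsto[where X="Sig _" and T=T] assms)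
qed

text \<open>One side of the book. The letter function \<open>c\<close> is instantiated to \<open>Ask\<close> and to \<open>Bid\<close>; a word of length
  at most \<open>K\<close> needs power letters up to \<open>K + 1\<close>.\<close>

lemma sig_linear_execution_leg:
  fixes c :: "nat \<Rightarrow> letter"
  assumes fps: "filtered_prob_space P F T" and sig: "is_signature P F T (alphabet M) X Sig"
    and M: "K + 1 \<le> M" and c: "\<And>m. m \<in> {1..M} \<Longrightarrow> c m \<in> alphabet M"
    and N: "AE \<omega> in P. pure_jump T (X (c 1)) \<omega>"
    and powers: "\<And>m. m \<in> {1..M} \<Longrightarrow> X (c m) = (if m = 1 then X (c 1) else jump_power_sum m (X (c 1)))"
    and others: "AE \<omega> in P. \<forall>v\<in>jump_times T (X (c 1)) \<omega>. \<forall>j\<in>base_alphabet. j \<noteq> c 1 \<longrightarrow> jump (X j) v \<omega> = 0"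
    and tilde: "\<And>J x. pairing (tilde_word J (c 1)) x =
      (\<Sum>(A, B)\<in>splits J. of_bool (set B \<subseteq> {c 1}) * (alpha0 (length B) * x (A @ [c (length B + 1)])))"
    and u: "u \<in> sig_coeffs K" and Z: "ito_integral P F T (left_limit (sig_linear u Sig)) (X (c 1)) Z"
  shows "AE \<omega> in P. \<forall>t\<in>{0..T}. Z t \<omega> = pairing (tilde u (c 1)) (\<lambda>J. Sig J t \<omega>)"
proof -
  let ?N = "X (c 1)"
  have base: "base_alphabet \<subseteq> alphabet M"
    using M unfolding base_alphabet_def alphabet_def by auto
  have J: "J \<in> lists base_alphabet \<and> length J + 1 \<le> M" if "J \<in> Poly_Mapping.keys u" for J
    using u that M unfolding sig_coeffs_def by fastforce
  have cadlag: "cadlag_on T (\<lambda>t. Sig J t \<omega>)" if "J \<in> Poly_Mapping.keys u" "\<omega> \<in> space P" for J \<omega>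
    using sig J[OF that(1)] base that(2) unfolding is_signature_def adapted_cadlag_def by (meson lists_mono subsetD)
  have "AE \<omega> in P. \<forall>J\<in>Poly_Mapping.keys u. \<forall>t\<in>{0..T}.
    (\<Sum>v\<in>jump_times T ?N \<omega> \<inter> {..t}. left_limit (Sig J) v \<omega> * jump ?N v \<omega>) = pairing (tilde_word J (c 1)) (\<lambda>J. Sig J t \<omega>)"
    unfolding tilde using J
    by (intro AE_finite_allI finite_keys ito_integral_signature_tilde[OF fps sig base c N powers others]) auto
  with ito_integral_pure_jump_integrator[OF fps Z N] AE_space show ?thesis
  proof eventually_elim
    case (elim \<omega>)
    show ?case
    proof
      fix t assume t: "t \<in> {0..T}"
      let ?D = "jump_times T ?N \<omega> \<inter> {..t}"
      have "Z t \<omega> = (\<Sum>v\<in>?D. left_limit (sig_linear u Sig) v \<omega> * jump ?N v \<omega>)"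
        using elim(1) t by blast
      also have "\<dots> = (\<Sum>v\<in>?D. pairing u (\<lambda>J. left_limit (Sig J) v \<omega>) * jump ?N v \<omega>)"
      proof (rule sum.cong)
        fix v assume "v \<in> ?D"
        then have "v \<in> {0<..T}" using jump_times_subset[of T ?N \<omega>] by auto
        then show "left_limit (sig_linear u Sig) v \<omega> * jump ?N v \<omega> = pairing u (\<lambda>J. left_limit (Sig J) v \<omega>) * jump ?N v \<omega>"
          using sig_linear_left_limit[where Sig=Sig and \<omega>=\<omega>, OF cadlag[OF _ elim(2)]] by simp
      qed simp
      also have "\<dots> = pairing u (\<lambda>J. \<Sum>v\<in>?D. left_limit (Sig J) v \<omega> * jump ?N v \<omega>)"
        unfolding pairing_def sum_distrib_left sum_distrib_right mult.assoc by (rule sum.swap)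
      also have "\<dots> = pairing u (\<lambda>J. pairing (tilde_word J (c 1)) (\<lambda>J. Sig J t \<omega>))"
        unfolding pairing_def[of u] using elim(3) t by (intro sum.cong) auto
      finally show "Z t \<omega> = pairing (tilde u (c 1)) (\<lambda>J. Sig J t \<omega>)"
        unfolding pairing_tilde .
    qed
  qed
qed

section \<open>Inventory profit-and-loss\<close>

text \<open>The coordinate of the one-letter word \<open>i\<close> is the pure-jump path itself, and it is integrated
  against a letter without jumps, so the jump part of the signature contributes nothing.\<close>

lemma signature_pure_jump_continuous_word:
  assumes fps: "filtered_prob_space P F T" and sig: "is_signature P F T A X Sig"
    and i: "i \<in> A" and l: "l \<in> A" and N: "AE \<omega> in P. pure_jump T (X i) \<omega>"
    and S: "\<And>\<omega> u. \<omega> \<in> space P \<Longrightarrow> u \<in> {0<..T} \<Longrightarrow> jump (X l) u \<omega> = 0"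
  shows "AE \<omega> in P. \<forall>t\<in>{0..T}. Sig [i, l] t \<omega> =
    (\<Sum>v\<in>jump_times T (X i) \<omega> \<inter> {..t}. jump (X i) v \<omega> * (X l t \<omega> - X l v \<omega>))"
proof -
  have Sig0: "left_limit (Sig []) v \<omega> = 1" if v: "v \<in> {0<..T}" and w: "\<omega> \<in> space P" for v \<omega>
  proof (rule left_limitI)
    have "eventually (\<lambda>s. 1 = Sig [] s \<omega>) (at_left v)"
      unfolding eventually_at_left_field using sig v w unfolding is_signature_def
      by (intro exI[of _ 0]) auto
    with tendsto_const show "((\<lambda>s. Sig [] s \<omega>) \<longlongrightarrow> 1) (at_left v)" by (rule Lim_transform_eventually)
  qed
  have "AE \<omega> in P. \<forall>t\<in>{0..T}. Sig [i] t \<omega> = (\<Sum>v\<in>jump_times T (X i) \<omega> \<inter> {..t}. jump (X i) v \<omega>)"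
    using signature_snoc_pure_jump[OF fps sig lists.Nil i N] AE_space
  proof eventually_elim
    case (elim \<omega>)
    have "splits ([] :: 'b list) = {([], [])}" unfolding splits_def by auto
    then have "Sig [i] t \<omega> = (\<Sum>v\<in>jump_times T (X i) \<omega> \<inter> {..t}. left_limit (Sig []) v \<omega> * jump (X i) v \<omega>)"
      if "t \<in> {0..T}" for t
      using elim(1) that by simp
    moreover have "(\<Sum>v\<in>jump_times T (X i) \<omega> \<inter> {..t}. left_limit (Sig []) v \<omega> * jump (X i) v \<omega>)
      = (\<Sum>v\<in>jump_times T (X i) \<omega> \<inter> {..t}. jump (X i) v \<omega>)" for t
      using jump_times_subset[of T "X i" \<omega>] by (intro sum.cong) (auto simp: Sig0[OF _ elim(2)] subset_iff)
    ultimately show ?case by simp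
  qed
  with N have eq1: "AE \<omega> in P. pure_jump T (Sig [i]) \<omega> \<and> jump_times T (Sig [i]) \<omega> = jump_times T (X i) \<omega> \<and>
      (\<forall>v\<in>{0<..T}. jump (Sig [i]) v \<omega> = jump (X i) v \<omega>)"
  proof eventually_elim
    case (elim \<omega>)
    then have fin: "finite (jump_times T (X i) \<omega>)" unfolding pure_jump_def by blast
    note D = this jump_times_subset[of T "X i" \<omega>]
    have "jump (Sig [i]) v \<omega> = jump (X i) v \<omega>" if v: "v \<in> {0<..T}" for v
      using step_path_jump[of _ T "Sig [i]" \<omega> "\<lambda>v. jump (X i) v \<omega>", OF D(1) _ v] elim(2) v
      unfolding jump_times_def by auto
    moreover have "pure_jump T (Sig [i]) \<omega>"
      using step_path_pure_jump[of _ T "Sig [i]" \<omega> "\<lambda>v. jump (X i) v \<omega>", OF D] elim(2) by blast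
    ultimately show ?case unfolding jump_times_def by auto
  qed
  have Ai: "[i] \<in> lists A" using i by simp
  obtain U where U: "ito_integral P F T (left_limit (Sig [i])) (X l) U"
    and eq: "AE \<omega> in P. \<forall>t\<in>{0..T}. Sig ([i] @ [l]) t \<omega> = U t \<omega> +
      (\<Sum>\<^sub>\<infinity>u\<in>{0<..t}. \<Sum>(J1, J2)\<in>splits [i]. of_bool (J2 \<noteq> []) *
        (1 / fact (length J2 + 1) * left_limit (Sig J1) u \<omega> * (\<Prod>j\<leftarrow>J2. jump (X j) u \<omega>) * jump (X l) u \<omega>))"
    by (rule signature_snoc_without_bracket[OF fps sig Ai l]) (use N in simp_all)
  have "AE \<omega> in P. pure_jump T (Sig [i]) \<omega>" using eq1 by eventually_elim blast
  from eq eq1 ito_integral_pure_jump_integrand[OF fps U this] AE_space show ?thesis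
  proof eventually_elim
    case (elim \<omega>)
    show ?case
    proof
      fix t assume t: "t \<in> {0..T}"
      have "(\<Sum>\<^sub>\<infinity>u\<in>{0<..t}. \<Sum>(J1, J2)\<in>splits [i]. of_bool (J2 \<noteq> []) *
        (1 / fact (length J2 + 1) * left_limit (Sig J1) u \<omega> * (\<Prod>j\<leftarrow>J2. jump (X j) u \<omega>) * jump (X l) u \<omega>)) = 0"
        using S[OF elim(4)] t by (intro infsum_0) (auto intro!: sum.neutral)
      moreover have "U t \<omega> = (\<Sum>v\<in>jump_times T (X i) \<omega> \<inter> {..t}. jump (X i) v \<omega> * (X l t \<omega> - X l v \<omega>))"
        using elim(2,3) t jump_times_subset[of T "X i" \<omega>] by (auto intro!: sum.cong)
      ultimately show "Sig [i, l] t \<omega> = (\<Sum>v\<in>jump_times T (X i) \<omega> \<inter> {..t}. jump (X i) v \<omega> * (X l t \<omega> - X l v \<omega>))"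
        using elim(1) t by simp
    qed
  qed
qed

text \<open>The jumps of the inventory are \<open>\<Delta>N\<^sup>b - \<Delta>N\<^sup>a\<close>. Its jump times may differ from the union of those of
  the two counting processes when jumps cancel, so all sums are taken over the union of the three
  sets.\<close>

lemma inventory_pnl_jumps:
  assumes fps: "filtered_prob_space P F T" and I: "inventory_pnl P F T Na Nb S I"
    and Na: "AE \<omega> in P. pure_jump T Na \<omega>" and Nb: "AE \<omega> in P. pure_jump T Nb \<omega>"
  shows "AE \<omega> in P. \<forall>t\<in>{0..T}. I t \<omega> =
    (\<Sum>v\<in>jump_times T Nb \<omega> \<inter> {..t}. jump Nb v \<omega> * (S t \<omega> - S v \<omega>)) -
    (\<Sum>v\<in>jump_times T Na \<omega> \<inter> {..t}. jump Na v \<omega> * (S t \<omega> - S v \<omega>))"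
proof -
  let ?Q = "inventory Na Nb"
  have Q: "pure_jump T ?Q \<omega> \<and> (\<forall>v\<in>{0<..T}. jump ?Q v \<omega> = jump Nb v \<omega> - jump Na v \<omega>)"
    if N: "pure_jump T Na \<omega>" "pure_jump T Nb \<omega>" for \<omega>
  proof -
    let ?D = "jump_times T Na \<omega> \<union> jump_times T Nb \<omega>"
    have D: "finite ?D" "?D \<subseteq> {0<..T}"
      using N jump_times_subset[of T Na \<omega>] jump_times_subset[of T Nb \<omega>] unfolding pure_jump_def by auto
    have Qt: "?Q t \<omega> = (\<Sum>v\<in>?D \<inter> {..t}. jump Nb v \<omega> - jump Na v \<omega>)" if "t \<in> {0..T}" for t
      using N that sum_jump_times[OF D, of Na \<omega> "\<lambda>v. jump Na v \<omega>" "{..t}"]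
        sum_jump_times[OF D, of Nb \<omega> "\<lambda>v. jump Nb v \<omega>" "{..t}"]
      unfolding pure_jump_def inventory_def sum_subtractf by auto
    have "jump ?Q v \<omega> = jump Nb v \<omega> - jump Na v \<omega>" if v: "v \<in> {0<..T}" for v
      using step_path_jump[of ?D T ?Q \<omega> "\<lambda>v. jump Nb v \<omega> - jump Na v \<omega>", OF D(1) Qt v] v
      unfolding jump_times_def by auto
    then show ?thesis
      using step_path_pure_jump[of ?D T ?Q \<omega> "\<lambda>v. jump Nb v \<omega> - jump Na v \<omega>", OF D Qt] by blast
  qed
  have "AE \<omega> in P. pure_jump T ?Q \<omega>" using Na Nb by eventually_elim (use Q in blast)
  from ito_integral_pure_jump_integrand[OF fps I[unfolded inventory_pnl_def] this] Na Nb show ?thesis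
  proof eventually_elim
    case (elim \<omega>)
    show ?case
    proof
      fix t assume t: "t \<in> {0..T}"
      let ?D = "jump_times T ?Q \<omega> \<union> jump_times T Na \<omega> \<union> jump_times T Nb \<omega>"
      have D: "finite ?D" "?D \<subseteq> {0<..T}"
        using elim Q[OF elim(2,3)] jump_times_subset[of T Na \<omega>] jump_times_subset[of T Nb \<omega>] jump_times_subset[of T ?Q \<omega>]
        unfolding pure_jump_def by auto
      have to_D: "(\<Sum>v\<in>jump_times T N \<omega> \<inter> {..t}. jump N v \<omega> * (S t \<omega> - S v \<omega>)) =
        (\<Sum>v\<in>?D \<inter> {..t}. jump N v \<omega> * (S t \<omega> - S v \<omega>))" if "jump_times T N \<omega> \<subseteq> ?D" for N
        by (rule sum_jump_times[OF D that]) simp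
      have "I t \<omega> = (\<Sum>v\<in>?D \<inter> {..t}. jump ?Q v \<omega> * (S t \<omega> - S v \<omega>))"
        using elim(1) t to_D[of ?Q] by auto
      also have "\<dots> = (\<Sum>v\<in>?D \<inter> {..t}. jump Nb v \<omega> * (S t \<omega> - S v \<omega>) - jump Na v \<omega> * (S t \<omega> - S v \<omega>))"
        using Q[OF elim(2,3)] D(2) by (intro sum.cong) (auto simp: left_diff_distrib)
      finally show "I t \<omega> = (\<Sum>v\<in>jump_times T Nb \<omega> \<inter> {..t}. jump Nb v \<omega> * (S t \<omega> - S v \<omega>)) -
        (\<Sum>v\<in>jump_times T Na \<omega> \<inter> {..t}. jump Na v \<omega> * (S t \<omega> - S v \<omega>))"
        unfolding sum_subtractf by (simp only: to_D Un_upper1 Un_upper2 le_supI1)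
    qed
  qed
qed

section \<open>Signature representation of revenue and inventory profit-and-loss\<close>

lemma continuous_jump_0:
  assumes "continuous_on {0..T} (\<lambda>t. X t \<omega>)" "u \<in> {0<..T}"
  shows "jump X u \<omega> = 0"
proof -
  have "((\<lambda>t. X t \<omega>) \<longlongrightarrow> X u \<omega>) (at u within {0..T})"
    using assms by (auto simp: continuous_on_def)
  moreover have "at u within {0..<u} \<le> at u within {0..T}" using assms by (intro at_le) auto
  moreover have "at u within {0..<u} = at_left u"
    using assms by (intro at_within_nhd[of u "{0<..}"]) auto
  ultimately have "((\<lambda>t. X t \<omega>) \<longlongrightarrow> X u \<omega>) (at_left u)" using tendsto_mono by metis
  then show ?thesis unfolding jump_def using left_limitI[of X] by simp
qed

theorem corollary2p8:
  fixes P :: "'a measure" and F :: "real \<Rightarrow> 'a measure" and T :: real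
    and K M :: nat
    and S QS Na Nb :: "real \<Rightarrow> 'a \<Rightarrow> real"
    and Sig :: "letter list \<Rightarrow> real \<Rightarrow> 'a \<Rightarrow> real"
    and \<alpha>a \<alpha>b :: "letter tensor"
    and \<delta> :: "(real \<Rightarrow> 'a \<Rightarrow> real) \<times> (real \<Rightarrow> 'a \<Rightarrow> real)"
    and Z I :: "real \<Rightarrow> 'a \<Rightarrow> real"
  assumes "filtered_prob_space P F T"
    and "M \<ge> max 2 (K + 1)"
    and "semimartingale P F T S"
    and "\<forall>\<omega>\<in>space P. continuous_on {0..T} (\<lambda>t. S t \<omega>)"
    and "quadratic_covariation P F T S S QS"
    and "counting_process P F T Na"
    and "counting_process P F T Nb"
    and "AE \<omega> in P. \<forall>t\<in>{0<..T}. jump Na t \<omega> * jump Nb t \<omega> = 0"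
    and "is_signature P F T (alphabet M) (state_process S QS Na Nb) Sig"
    and "\<alpha>a \<in> sig_coeffs K"
    and "\<alpha>b \<in> sig_coeffs K"
    and "\<delta> = (sig_linear \<alpha>a Sig, sig_linear \<alpha>b Sig)"
    and "execution_revenue P F T Na Nb \<delta> Z"
    and "inventory_pnl P F T Na Nb S I"
  shows "\<forall>t\<in>{0..T}. AE \<omega> in P.
      Z t \<omega> = pairing (tilde \<alpha>a (Ask 1) + tilde \<alpha>b (Bid 1)) (\<lambda>J. Sig J t \<omega>) \<and>
      I t \<omega> = pairing (tilde (eps [Bid 1] - eps [Ask 1]) Mid) (\<lambda>J. Sig J t \<omega>)"
proof -
  note fps = assms(1) and sig = assms(9)
  have T: "0 < T" using fps unfolding filtered_prob_space_def by blast
  have M: "K + 1 \<le> M" using assms(2) by simp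
  let ?X = "state_process S QS Na Nb"
  have S_jump: "jump S u \<omega> = 0" if "\<omega> \<in> space P" "u \<in> {0<..T}" for u \<omega>
    using continuous_jump_0[of T S \<omega> u] assms(4) that by blast
  have time_jump: "jump (\<lambda>t \<omega>. t) u \<omega> = 0" if "u \<in> {0<..T}" for u and \<omega> :: 'a
    using continuous_jump_0[of T "\<lambda>t \<omega>. t" \<omega> u] that by simp
  have Na: "AE \<omega> in P. pure_jump T Na \<omega>" and Nb: "AE \<omega> in P. pure_jump T Nb \<omega>"
    using counting_process_pure_jump[OF T assms(6)] counting_process_pure_jump[OF T assms(7)]
    by (auto intro!: AE_I2)
  have letters: "Ask m \<in> alphabet M" "Bid m \<in> alphabet M" if "m \<in> {1..M}" for m
    using that unfolding alphabet_def by auto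
  \<comment> \<open>At a jump of one counting process the other does not jump, and time and mid-price are continuous.\<close>
  have others_a: "AE \<omega> in P. \<forall>v\<in>jump_times T Na \<omega>. \<forall>j\<in>base_alphabet. j \<noteq> Ask 1 \<longrightarrow> jump (?X j) v \<omega> = 0"
    using assms(8) AE_space
    by eventually_elim (auto simp: jump_times_def base_alphabet_def S_jump time_jump)
  have others_b: "AE \<omega> in P. \<forall>v\<in>jump_times T Nb \<omega>. \<forall>j\<in>base_alphabet. j \<noteq> Bid 1 \<longrightarrow> jump (?X j) v \<omega> = 0"
    using assms(8) AE_space
    by eventually_elim (auto simp: jump_times_def base_alphabet_def S_jump time_jump)
  obtain Za Zb where Za: "ito_integral P F T (left_limit (sig_linear \<alpha>a Sig)) Na Za"
    and Zb: "ito_integral P F T (left_limit (sig_linear \<alpha>b Sig)) Nb Zb"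
    and Z: "AE \<omega> in P. \<forall>t\<in>{0..T}. Z t \<omega> = Za t \<omega> + Zb t \<omega>"
    using assms(13) unfolding execution_revenue_def assms(12) by auto
  have "AE \<omega> in P. \<forall>t\<in>{0..T}. Za t \<omega> = pairing (tilde \<alpha>a (Ask 1)) (\<lambda>J. Sig J t \<omega>)"
    using Na Za others_a letters(1) assms(10)
    by (intro sig_linear_execution_leg[OF fps sig M _ _ _ _ pairing_tilde_word_Ask]) auto
  moreover have "AE \<omega> in P. \<forall>t\<in>{0..T}. Zb t \<omega> = pairing (tilde \<alpha>b (Bid 1)) (\<lambda>J. Sig J t \<omega>)"
    using Nb Zb others_b letters(2) assms(11)
    by (intro sig_linear_execution_leg[OF fps sig M _ _ _ _ pairing_tilde_word_Bid]) auto
  moreover have X: "?X (Ask 1) = Na" "?X (Bid 1) = Nb" "?X Mid = S" and Mid: "Mid \<in> alphabet M"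
    by (simp_all add: alphabet_def)
  have "AE \<omega> in P. \<forall>t\<in>{0..T}. Sig [Ask 1, Mid] t \<omega> =
      (\<Sum>v\<in>jump_times T Na \<omega> \<inter> {..t}. jump Na v \<omega> * (S t \<omega> - S v \<omega>))"
    using M by (intro signature_pure_jump_continuous_word[OF fps sig letters(1) Mid, of 1, unfolded X, OF _ Na S_jump]) auto
  moreover have "AE \<omega> in P. \<forall>t\<in>{0..T}. Sig [Bid 1, Mid] t \<omega> =
      (\<Sum>v\<in>jump_times T Nb \<omega> \<inter> {..t}. jump Nb v \<omega> * (S t \<omega> - S v \<omega>))"
    using M by (intro signature_pure_jump_continuous_word[OF fps sig letters(2) Mid, of 1, unfolded X, OF _ Nb S_jump]) auto
  moreover note inventory_pnl_jumps[OF fps assms(14) Na Nb]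
  ultimately have "AE \<omega> in P. \<forall>t\<in>{0..T}.
      Z t \<omega> = pairing (tilde \<alpha>a (Ask 1) + tilde \<alpha>b (Bid 1)) (\<lambda>J. Sig J t \<omega>) \<and>
      I t \<omega> = pairing (tilde (eps [Bid 1] - eps [Ask 1]) Mid) (\<lambda>J. Sig J t \<omega>)"
    using Z
    by eventually_elim (simp add: pairing_add pairing_tilde pairing_diff pairing_tilde_word_Mid)
  then show ?thesis by (auto elim: eventually_mono)
qed

end
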